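(* Let $\mu_0,\mu_1$ be as in the context. There exist $C,\varepsilon_0>0$ such that for every $0<\varepsilon<\varepsilon_0$: (i) $f_\varepsilon$ is convex on $\Omega_0$ and $f_\varepsilon\in\mathcal{C}^1(\Omega_0)$; (ii) $f_\varepsilon$ is twice differentiable almost everywhere on $\Omega_0$; in fact, it is twice differentiable at every point of $\Omega_0$ except (possibly) the two points $x^{(m)},x^{(M)}$ defined in the context; (iii) $f_\varepsilon$ is uniformly strongly convex, with $$\operatorname*{ess\,sup}_{\Omega_0} f_\varepsilon''\le C\quad\text{and}\quad \operatorname*{ess\,inf}_{\Omega_0} f_\varepsilon''\ge C^{-1};$$ similarly, the same bounds hold with the essential supremum and infimum replaced by the pointwise supremum and infimum over $\Omega_0\setminus\{x^{(m)},x^{(M)}\}$. The constant $C$ depends only on the constants $\lambda,\Lambda$ and on the moduli of continuity of the densities $u_0,u_1$.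
   Context: Standing assumption: for $i=0,1$, $\mu_i$ is a probability measure on $\mathbb{R}$ supported on a compact interval $\Omega_i=[a_i,b_i]$, with a continuous density $u_i\in\mathcal{C}(\Omega_i)$ (i.e. $d\mu_i=u_i\,dx$) satisfying $0<\lambda\le u_i\le\Lambda<\infty$ on $\Omega_i$ for constants $\lambda,\Lambda$. For $\varepsilon>0$, let $\pi_\varepsilon$ be the unique minimizer over couplings $\pi\in\Pi(\mu_0,\mu_1)$ of $\int\frac12(x-y)^2\,d\pi+\frac{\varepsilon}{2}\int\big(\frac{d\pi}{d(\mu_0\otimes\mu_1)}\big)^2d(\mu_0\otimes\mu_1)$. The potentials $(f_\varepsilon,g_\varepsilon)$ are continuous functions $f_\varepsilon:\Omega_0\to\mathbb{R}$, $g_\varepsilon:\Omega_1\to\mathbb{R}$ with $\frac{d\pi_\varepsilon}{d(\mu_0\otimes\mu_1)}(x,y)=\big(\frac{xy-f_\varepsilon(x)-g_\varepsilon(y)}{\varepsilon}\big)_+$, where $(a)_+=\max(a,0)$; equivalently they satisfy $\int(xy-f_\varepsilon(x)-g_\varepsilon(y))_+\,d\mu_1(y)=\varepsilon$ for all $x\in\Omega_0$ and $\int(xy-f_\varepsilon(x)-g_\varepsilon(y))_+\,d\mu_0(x)=\varepsilon$ for all $y\in\Omega_1$. They exist and are unique up to replacing $(f_\varepsilon,g_\varepsilon)$ by $(f_\varepsilon+\alpha,g_\varepsilon-\alpha)$, $\alpha\in\mathbb{R}$. At endpoints of $\Omega_0$ derivatives are one-sided. Notation: $\xi(x,y)=xy-f_\varepsilon(x)-g_\varepsilon(y)$.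 For $x\in\Omega_0$, the set $\{y\in\Omega_1:\xi(x,y)\ge0\}$ is a compact interval $[y_m(x),y_M(x)]$ (as $g_\varepsilon$ is convex). For all sufficiently small $\varepsilon$, $x^{(M)}$ denotes the unique point $x\in(a_0,b_0)$ with $y_M(x)=b_1$ and $\xi(x,y_M(x))=0$, and $x^{(m)}$ the unique point $x\in(a_0,b_0)$ with $y_m(x)=a_1$ and $\xi(x,y_m(x))=0$. *)

theory Defs
  imports "HOL-Probability.Probability"
begin

section \<open>Marginals\<close>

text \<open>A modulus of continuity, as a function on \<open>[0, \<infinity>)\<close>; values at negative arguments are irrelevant.\<close>

definition modulus_of_continuity :: "(real \<Rightarrow> real) \<Rightarrow> bool" where
  "modulus_of_continuity \<omega> \<longleftrightarrow>
     mono_on {0..} \<omega> \<and> \<omega> 0 = 0 \<and> (\<omega> \<longlongrightarrow> 0) (at_right 0)"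

definition has_modulus_on :: "real set \<Rightarrow> (real \<Rightarrow> real) \<Rightarrow> (real \<Rightarrow> real) \<Rightarrow> bool" where
  "has_modulus_on S u \<omega> \<longleftrightarrow> (\<forall>x\<in>S. \<forall>y\<in>S. \<bar>u x - u y\<bar> \<le> \<omega> \<bar>x - y\<bar>)"

text \<open>Only the values of \<open>u\<close> on \<open>[a, b]\<close> matter. Nondegeneracy \<open>a < b\<close> follows from \<open>\<mu>\<close> being a
  probability measure.\<close>

definition marginal_with_density ::
  "real \<Rightarrow> real \<Rightarrow> real \<Rightarrow> real \<Rightarrow> (real \<Rightarrow> real) \<Rightarrow> real measure \<Rightarrow> bool" where
  "marginal_with_density l L a b u \<mu> \<longleftrightarrow>
     prob_space \<mu> \<and>
     \<mu> = density lborel (\<lambda>x. ennreal (indicator {a..b} x * u x)) \<and>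
     continuous_on {a..b} u \<and>
     (\<forall>x\<in>{a..b}. l \<le> u x \<and> u x \<le> L)"

section \<open>Quadratically regularized optimal transport\<close>

definition couplings :: "real measure \<Rightarrow> real measure \<Rightarrow> (real \<times> real) measure set" where
  "couplings \<mu> \<nu> =
     {\<pi>. sets \<pi> = sets (borel \<Otimes>\<^sub>M borel) \<and> distr \<pi> borel fst = \<mu> \<and> distr \<pi> borel snd = \<nu>}"

text \<open>The regularization term is infinite if the plan is not absolutely continuous with respect
  to the product of the marginals.\<close>

definition qot_cost ::
  "real \<Rightarrow> real measure \<Rightarrow> real measure \<Rightarrow> (real \<times> real) measure \<Rightarrow> ennreal" where
  "qot_cost \<epsilon> \<mu> \<nu> \<pi> =
     (\<integral>\<^sup>+ (x, y). ennreal ((x - y)\<^sup>2 / 2) \<partial>\<pi>) +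
     (if absolutely_continuous (\<mu> \<Otimes>\<^sub>M \<nu>) \<pi>
      then ennreal (\<epsilon> / 2) * (\<integral>\<^sup>+ z. (RN_deriv (\<mu> \<Otimes>\<^sub>M \<nu>) \<pi> z)\<^sup>2 \<partial>(\<mu> \<Otimes>\<^sub>M \<nu>))
      else \<infinity>)"

definition qot_minimizer ::
  "real \<Rightarrow> real measure \<Rightarrow> real measure \<Rightarrow> (real \<times> real) measure \<Rightarrow> bool" where
  "qot_minimizer \<epsilon> \<mu> \<nu> \<pi> \<longleftrightarrow>
     \<pi> \<in> couplings \<mu> \<nu> \<and> (\<forall>\<pi>'\<in>couplings \<mu> \<nu>. qot_cost \<epsilon> \<mu> \<nu> \<pi> \<le> qot_cost \<epsilon> \<mu> \<nu> \<pi>')"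

definition \<xi> :: "(real \<Rightarrow> real) \<Rightarrow> (real \<Rightarrow> real) \<Rightarrow> real \<Rightarrow> real \<Rightarrow> real" where
  "\<xi> f g x y = x * y - f x - g y"

text \<open>Potentials on \<open>S \<times> T\<close>: the density identity holds almost everywhere, so only the values of
  \<open>f\<close> on \<open>S\<close> and of \<open>g\<close> on \<open>T\<close> matter when \<open>\<mu>\<close> and \<open>\<nu>\<close> live on \<open>S\<close> and \<open>T\<close>.\<close>

definition qot_potentials ::
  "real \<Rightarrow> real set \<Rightarrow> real set \<Rightarrow> real measure \<Rightarrow> real measure
    \<Rightarrow> (real \<Rightarrow> real) \<Rightarrow> (real \<Rightarrow> real) \<Rightarrow> bool" where
  "qot_potentials \<epsilon> S T \<mu> \<nu> f g \<longleftrightarrow>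
     continuous_on S f \<and> continuous_on T g \<and>
     (\<exists>\<pi>. qot_minimizer \<epsilon> \<mu> \<nu> \<pi> \<and> absolutely_continuous (\<mu> \<Otimes>\<^sub>M \<nu>) \<pi> \<and>
        (AE (x, y) in \<mu> \<Otimes>\<^sub>M \<nu>.
           RN_deriv (\<mu> \<Otimes>\<^sub>M \<nu>) \<pi> (x, y) = ennreal (max (\<xi> f g x y / \<epsilon>) 0)))"

section \<open>Sections of the support\<close>

definition y_min :: "real set \<Rightarrow> (real \<Rightarrow> real) \<Rightarrow> (real \<Rightarrow> real) \<Rightarrow> real \<Rightarrow> real" where
  "y_min T f g x = Inf {y\<in>T. \<xi> f g x y \<ge> 0}"

definition y_max :: "real set \<Rightarrow> (real \<Rightarrow> real) \<Rightarrow> (real \<Rightarrow> real) \<Rightarrow> real \<Rightarrow> real" where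
  "y_max T f g x = Sup {y\<in>T. \<xi> f g x y \<ge> 0}"

definition is_x_m ::
  "real \<Rightarrow> real \<Rightarrow> real \<Rightarrow> real \<Rightarrow> (real \<Rightarrow> real) \<Rightarrow> (real \<Rightarrow> real) \<Rightarrow> real \<Rightarrow> bool" where
  "is_x_m a0 b0 a1 b1 f g x \<longleftrightarrow>
     x \<in> {a0<..<b0} \<and> y_min {a1..b1} f g x = a1 \<and> \<xi> f g x (y_min {a1..b1} f g x) = 0"

definition is_x_M ::
  "real \<Rightarrow> real \<Rightarrow> real \<Rightarrow> real \<Rightarrow> (real \<Rightarrow> real) \<Rightarrow> (real \<Rightarrow> real) \<Rightarrow> real \<Rightarrow> bool" where
  "is_x_M a0 b0 a1 b1 f g x \<longleftrightarrow>
     x \<in> {a0<..<b0} \<and> y_max {a1..b1} f g x = b1 \<and> \<xi> f g x (y_max {a1..b1} f g x) = 0"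

definition x_m ::
  "real \<Rightarrow> real \<Rightarrow> real \<Rightarrow> real \<Rightarrow> (real \<Rightarrow> real) \<Rightarrow> (real \<Rightarrow> real) \<Rightarrow> real" where
  "x_m a0 b0 a1 b1 f g = (THE x. is_x_m a0 b0 a1 b1 f g x)"

definition x_M ::
  "real \<Rightarrow> real \<Rightarrow> real \<Rightarrow> real \<Rightarrow> (real \<Rightarrow> real) \<Rightarrow> (real \<Rightarrow> real) \<Rightarrow> real" where
  "x_M a0 b0 a1 b1 f g = (THE x. is_x_M a0 b0 a1 b1 f g x)"

section \<open>Regularity on an interval\<close>

text \<open>All derivatives are taken within \<open>S\<close>, hence are one-sided at the endpoints of an interval.\<close>

definition C1_on :: "real set \<Rightarrow> (real \<Rightarrow> real) \<Rightarrow> bool" where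
  "C1_on S f \<longleftrightarrow>
     (\<exists>f'. (\<forall>x\<in>S. (f has_real_derivative f' x) (at x within S)) \<and> continuous_on S f')"

definition deriv_on :: "real set \<Rightarrow> (real \<Rightarrow> real) \<Rightarrow> real \<Rightarrow> real" where
  "deriv_on S f x = vector_derivative f (at x within S)"

definition deriv2_on :: "real set \<Rightarrow> (real \<Rightarrow> real) \<Rightarrow> real \<Rightarrow> real" where
  "deriv2_on S f = deriv_on S (deriv_on S f)"

definition twice_differentiable_within :: "real set \<Rightarrow> (real \<Rightarrow> real) \<Rightarrow> real \<Rightarrow> bool" where
  "twice_differentiable_within S f x \<longleftrightarrow>
     (f differentiable (at x within S)) \<and>
     (\<forall>\<^sub>F z in at x within S. f differentiable (at z within S)) \<and>
     (deriv_on S f differentiable (at x within S))"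

definition strongly_convex_on :: "real set \<Rightarrow> real \<Rightarrow> (real \<Rightarrow> real) \<Rightarrow> bool" where
  "strongly_convex_on S k f \<longleftrightarrow>
     (\<forall>x\<in>S. \<forall>y\<in>S. \<forall>t\<in>{0..1}.
        f ((1 - t) * x + t * y) \<le> (1 - t) * f x + t * f y - k / 2 * t * (1 - t) * (x - y)\<^sup>2)"

text \<open>Like \<^const>\<open>esssup\<close>, which is \<open>\<infinity>\<close> on nonmeasurable functions, this is \<open>-\<infinity>\<close> on them.\<close>

definition essinf :: "'a measure \<Rightarrow> ('a \<Rightarrow> ereal) \<Rightarrow> ereal" where
  "essinf M f = - esssup M (\<lambda>x. - f x)"

end

theory Submission
  imports Defs
begin

text \<open>
  Write \<open>h\<close> for the length of a section \<open>[ym x, yM x]\<close> of the support of the plan. The potentials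
  solve the two marginal equations: \<open>\<integral> \<xi>(x, y)\<^sub>+ d\<mu>\<^sub>1(y) = \<epsilon>\<close> for every \<open>x\<close>, and the same with the roles
  of the variables exchanged. Comparing the equations at \<open>x\<close> and \<open>x'\<close> through the convexity of the positive
  part gives \<open>bary x * (x' - x) \<le> f x' - f x\<close>, where \<open>bary x\<close> is the barycentre of \<open>\<mu>\<^sub>1\<close> on the section
  at \<open>x\<close> (\<open>bary_subgradient\<close>). The ends of the section move continuously, so \<open>f' = bary\<close> is
  continuous, and \<open>f''\<close> exists wherever both ends of the section are differentiable. An end \<open>q\<close> that
  lies strictly inside \<open>[a1, b1]\<close> moves with speed \<open>(q - f' x) / (g' q - x)\<close>, by implicit
  differentiation of \<open>\<xi>(x, q) = 0\<close>; an end at which \<open>\<xi> > 0\<close> is stuck at the boundary. The exceptional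
  points \<open>x\<^sup>m\<close> and \<open>x\<^sup>M\<close> are those where an end passes from one regime to the other.

  The curvature bounds rest on one quantitative fact (\<open>section_width\<close>): every section, in either
  variable, satisfies \<open>h\<^sup>3 \<le> K * \<epsilon>\<close> with \<open>K\<close> depending on \<open>l\<close> and \<open>L\<close> alone. Suppose that \<open>h\<^sup>3\<close> is
  much larger than \<open>\<epsilon>\<close> at some \<open>x\<close>. The concave function \<open>\<xi>(x, \<cdot>)\<close> has integral \<open>\<epsilon>\<close> over a section of
  length \<open>h\<close>, so its height is of order \<open>\<epsilon> / h\<close>, and over the middle half of the section its slope \<open>x - g' y\<close>
  is at most of order \<open>\<epsilon> / h\<^sup>2\<close>, much less than \<open>h\<close>. As \<open>g' y\<close> is the barycentre of the
  \<open>x\<close>-section over \<open>y\<close>, these \<open>x\<close>-sections are balanced around \<open>x\<close>. The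
  mass of \<open>\<mu>\<^sub>1\<close> between two of the middle points comes from the \<open>x\<close>-sections over them, so one of these must extend to a distance of order \<open>h\<close> from
  \<open>x\<close> on one side, and, being balanced, on the other side too. The support therefore contains the
  corners of a rectangle whose sides are of order \<open>h\<close>. The mixed second difference of \<open>\<xi>\<close>
  over a rectangle is its area, here of order \<open>h\<^sup>2\<close>, whereas the values of \<open>\<xi>\<close> in the support are of
  order \<open>\<epsilon> / h\<close>: a contradiction.

  The slope \<open>s = g' q - x\<close> in the speed of an interior end \<open>q\<close> obeys \<open>\<epsilon> \<le> L * h\<^sup>2 * s\<close>, by concavity, and
  it is at most the length of the \<open>x\<close>-section over \<open>q\<close>. With the bound on the widths this
  confines the speed between two positive constants (\<open>end_slope\<close>, \<open>yM_derivative\<close>). Once \<open>\<epsilon>\<close> is so small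
  that no section is all of \<open>[a1, b1]\<close>, at least one end is interior, and differentiating the
  barycentre bounds \<open>f''\<close> from both sides (\<open>bary_derivative\<close>).
\<close>

section \<open>One-variable calculus\<close>

lemma weighted_integral_strict_mono:
  fixes \<phi> \<psi> u :: "real \<Rightarrow> real"
  assumes "a < b" and c: "continuous_on {a..b} \<phi>" "continuous_on {a..b} \<psi>" "continuous_on {a..b} u"
    and u: "\<And>y. y \<in> {a..b} \<Longrightarrow> 0 < u y"
    and le: "\<And>y. y \<in> {a..b} \<Longrightarrow> \<phi> y \<le> \<psi> y" and z: "z \<in> {a..b}" "\<phi> z < \<psi> z"
  shows "integral {a..b} (\<lambda>y. \<phi> y * u y) < integral {a..b} (\<lambda>y. \<psi> y * u y)"
proof -
  let ?d = "\<lambda>y. (\<psi> y - \<phi> y) * u y"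
  have cd: "continuous_on {a..b} ?d" by (intro continuous_intros c)
  have nonneg: "\<And>y. y \<in> {a..b} \<Longrightarrow> 0 \<le> ?d y"
    using le u by (simp add: less_imp_le)
  have "?d z \<noteq> 0" using z u[OF z(1)] by auto
  hence "integral {a..b} ?d \<noteq> 0"
    using integral_eq_0_iff[OF cd \<open>a < b\<close> nonneg] z(1) by blast
  moreover have "0 \<le> integral {a..b} ?d"
    by (rule integral_nonneg) (use cd nonneg in \<open>auto intro: integrable_continuous_interval\<close>)
  moreover have "integral {a..b} ?d
      = integral {a..b} (\<lambda>y. \<psi> y * u y) - integral {a..b} (\<lambda>y. \<phi> y * u y)"
    by (subst integral_diff[symmetric])
       (auto intro!: integrable_continuous_interval continuous_intros c simp: left_diff_distrib)
  ultimately show ?thesis by linarith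
qed

lemma integral_outside_zero:
  fixes h :: "real \<Rightarrow> real"
  assumes "c \<le> p" "p \<le> q" "q \<le> d" "\<And>y. y \<in> {c..d} \<Longrightarrow> y \<notin> {p..q} \<Longrightarrow> h y = 0"
  shows "integral {c..d} h = integral {p..q} h"
proof -
  have "integral {c..d} h = integral {c..d} (\<lambda>y. if y \<in> {p..q} then h y else 0)"
    using assms by (intro integral_cong) auto
  also have "\<dots> = integral {p..q} h"
    using assms by (subst Henstock_Kurzweil_Integration.integral_restrict_Int)
      (auto intro!: arg_cong2[where f = integral])
  finally show ?thesis .
qed

lemma eventually_in_domain: "\<forall>\<^sub>F x' in at x within S. x' \<in> S" for S :: "real set"
  by (simp add: eventually_at_filter)

text \<open>The fundamental theorem of calculus tolerates finitely many points without a derivative, which is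
  how the two exceptional points are crossed.\<close>

lemma derivative_growth:
  fixes H d :: "real \<Rightarrow> real"
  assumes cont: "continuous_on {a..b} H" and E: "finite E"
    and deriv: "\<And>x. x \<in> {a..b} - E \<Longrightarrow> (H has_real_derivative d x) (at x within {a..b})"
    and ge: "\<And>x. x \<in> {a..b} - E \<Longrightarrow> k \<le> d x"
    and x: "x \<in> {a..b}" "x' \<in> {a..b}" "x \<le> x'"
  shows "k * (x' - x) \<le> H x' - H x"
proof (rule has_integral_le)
  show "((\<lambda>_. k) has_integral k * (x' - x)) {x..x'}"
    using has_integral_const_real[of k x x'] x(3) by (simp add: mult.commute)
  let ?d = "\<lambda>z. if z \<in> {a..b} - E then d z else k"
  show "(?d has_integral H x' - H x) {x..x'}"
  proof (rule fundamental_theorem_of_calculus_interior_strong[OF E x(3)])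
    fix z assume z: "z \<in> {x<..<x'} - E"
    hence "at z within {a..b} = at z" using x by (intro at_within_Icc_at) auto
    thus "(H has_vector_derivative ?d z) (at z)"
      using deriv[of z] z x by (auto simp: has_real_derivative_iff_has_vector_derivative)
  next
    show "continuous_on {x..x'} H" using x by (intro continuous_on_subset[OF cont]) auto
  qed
  show "k \<le> ?d z" for z using ge by simp
qed

text \<open>Subtract from the function its tangent at a point and a parabola with vertex there: growth of the
  derivative makes the rest monotone on either side of the point, so the function has a quadratic
  lower support. Averaging this support at a convex combination of two points gives strong convexity.\<close>

lemma strongly_convex_on_if_derivative_growth:
  fixes H H' :: "real \<Rightarrow> real"
  assumes deriv: "\<And>x. x \<in> {a..b} \<Longrightarrow> (H has_real_derivative H' x) (at x within {a..b})"
    and growth: "\<And>x x'. x \<in> {a..b} \<Longrightarrow> x' \<in> {a..b} \<Longrightarrow> x \<le> x' \<Longrightarrow> k * (x' - x) \<le> H' x' - H' x"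
  shows "strongly_convex_on {a..b} k H"
proof -
  have cont: "continuous_on {a..b} H"
    using deriv by (meson DERIV_continuous_on)
  have support: "H x + H' x * (z - x) + k / 2 * (z - x)\<^sup>2 \<le> H z"
    if x: "x \<in> {a..b}" and z: "z \<in> {a..b}" for x z
  proof -
    define \<phi> where "\<phi> t = H t - H x - H' x * (t - x) - k / 2 * (t - x)\<^sup>2" for t
    have \<phi>_cont: "continuous_on S \<phi>" if "S \<subseteq> {a..b}" for S
      unfolding \<phi>_def by (intro continuous_intros continuous_on_subset[OF cont that])
    have \<phi>_deriv: "(\<phi> has_real_derivative H' t - H' x - k * (t - x)) (at t)" if "t \<in> {a<..<b}" for t
    proof -
      have "at t within {a..b} = at t" using that by (intro at_within_Icc_at) auto
      hence "(H has_real_derivative H' t) (at t)" using deriv[of t] that by simp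
      thus ?thesis unfolding \<phi>_def[abs_def] by (auto intro!: derivative_eq_intros)
    qed
    have "0 \<le> \<phi> z"
    proof (cases "x \<le> z")
      case True
      have "\<phi> x \<le> \<phi> z"
      proof (rule DERIV_nonneg_imp_increasing_open[where f = \<phi>, OF True])
        fix t assume t: "x < t" "t < z"
        have "k * (t - x) \<le> H' t - H' x" using t x z by (intro growth) auto
        thus "\<exists>y. (\<phi> has_real_derivative y) (at t) \<and> 0 \<le> y"
          using \<phi>_deriv[of t] t x z by (intro exI conjI) auto
      qed (use x z in \<open>intro \<phi>_cont, auto\<close>)
      thus ?thesis by (simp add: \<phi>_def)
    next
      case False
      have "- \<phi> z \<le> - \<phi> x"
      proof (rule DERIV_nonneg_imp_increasing_open[where f = "\<lambda>t. - \<phi> t"])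
        fix t assume t: "z < t" "t < x"
        have "k * (x - t) \<le> H' x - H' t" using t x z by (intro growth) auto
        hence "0 \<le> - (H' t - H' x - k * (t - x))" by (simp add: algebra_simps)
        thus "\<exists>y. ((\<lambda>t. - \<phi> t) has_real_derivative y) (at t) \<and> 0 \<le> y"
          using DERIV_minus[OF \<phi>_deriv[of t]] t x z by (intro exI conjI) auto
      qed (use x z False in \<open>auto intro!: continuous_on_minus \<phi>_cont\<close>)
      thus ?thesis by (simp add: \<phi>_def)
    qed
    thus ?thesis by (simp add: \<phi>_def)
  qed
  show ?thesis unfolding strongly_convex_on_def
  proof (intro ballI)
    fix x y t :: real assume h: "x \<in> {a..b}" "y \<in> {a..b}" "t \<in> {0..1}"
    let ?w = "(1 - t) * x + t * y"
    have w: "?w \<in> {a..b}"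
      using h convexD[OF convex_real_interval(5)[of a b], of x y "1 - t" t] by auto
    have "(1 - t) * (H ?w + H' ?w * (x - ?w) + k / 2 * (x - ?w)\<^sup>2)
        + t * (H ?w + H' ?w * (y - ?w) + k / 2 * (y - ?w)\<^sup>2) \<le> (1 - t) * H x + t * H y"
      using h by (intro add_mono mult_left_mono support w) auto
    moreover have "(1 - t) * (H ?w + H' ?w * (x - ?w) + k / 2 * (x - ?w)\<^sup>2)
        + t * (H ?w + H' ?w * (y - ?w) + k / 2 * (y - ?w)\<^sup>2) = H ?w + k / 2 * t * (1 - t) * (x - y)\<^sup>2"
      by (simp add: field_simps power2_eq_square)
    ultimately show "H ?w \<le> (1 - t) * H x + t * H y - k / 2 * t * (1 - t) * (x - y)\<^sup>2" by linarith
  qed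
qed

text \<open>Off a finite set the derivative is the limit of the difference quotients to the right, which are
  Borel functions once the function is extended by constants. The right end of the interval has no
  such quotients and joins the exceptional set.\<close>

lemma derivative_measurable:
  fixes H d :: "real \<Rightarrow> real"
  assumes "a < b" and cont: "continuous_on {a..b} H" and E: "finite E"
    and deriv: "\<And>x. x \<in> {a..b} - E \<Longrightarrow> (H has_real_derivative d x) (at x within {a..b})"
  shows "d \<in> borel_measurable (lebesgue_on {a..b})"
proof -
  define E' where "E' = (E \<union> {b}) \<inter> {a..b}"
  have E': "finite E'" using E by (simp add: E'_def)
  define T where "T x = H (max a (min b x))" for x
  have "continuous_on UNIV T"
    unfolding T_def using \<open>a < b\<close>
    by (intro continuous_on_compose2[OF cont]) (auto intro!: continuous_intros)
  hence [measurable]: "T \<in> borel_measurable borel" by (rule borel_measurable_continuous_onI)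
  define q where "q n x = (T (x + 1 / Suc n) - T x) / (1 / Suc n)" for n :: nat and x
  have [measurable]: "q n \<in> borel_measurable borel" for n unfolding q_def[abs_def] by measurable
  have [measurable]: "E' \<in> sets borel" using E' by (simp add: sets.countable countable_finite)
  have "(\<lambda>x. if x \<in> E' then 0 else q n x) \<in> borel_measurable borel" for n by measurable
  hence meas: "(\<lambda>x. if x \<in> E' then 0 else q n x) \<in> borel_measurable (lebesgue_on {a..b})" for n
    by (intro measurable_restrict_space1 measurable_completion) simp
  have "(\<lambda>x. if x \<in> E' then 0 else d x) \<in> borel_measurable (lebesgue_on {a..b})"
  proof (rule borel_measurable_LIMSEQ_real[OF _ meas])
    fix x assume "x \<in> space (lebesgue_on {a..b})"
    hence x: "x \<in> {a..b}" by simp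
    show "(\<lambda>n. if x \<in> E' then 0 else q n x) \<longlonglongrightarrow> (if x \<in> E' then 0 else d x)"
    proof (cases "x \<in> E'")
      case False
      hence x': "x < b" "x \<notin> E" using x by (auto simp: E'_def)
      have lim: "((\<lambda>y. (H y - H x) / (y - x)) \<longlongrightarrow> d x) (at x within {a..b})"
        using deriv[of x] x x'(2) by (simp add: has_field_derivative_iff)
      have seq: "(\<lambda>n. 1 / real (Suc n)) \<longlonglongrightarrow> 0" by (rule LIMSEQ_Suc[OF lim_1_over_n])
      have "(\<lambda>n. x + 1 / real (Suc n)) \<longlonglongrightarrow> x" using tendsto_add[OF tendsto_const seq, of x] by simp
      moreover have ev: "\<forall>\<^sub>F n in sequentially. 1 / real (Suc n) < b - x"
        using order_tendstoD(2)[OF seq, of "b - x"] x' by simp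
      moreover have "x + 1 / real (Suc n) \<in> {a..b} \<and> x + 1 / real (Suc n) \<noteq> x"
        if "1 / real (Suc n) < b - x" for n
      proof -
        have "0 < 1 / real (Suc n)" by simp
        thus ?thesis using that x unfolding atLeastAtMost_iff by linarith
      qed
      ultimately have "filterlim (\<lambda>n. x + 1 / real (Suc n)) (at x within {a..b}) sequentially"
        unfolding filterlim_at by (intro conjI) (auto elim!: eventually_mono)
      from filterlim_compose[OF lim this]
      have "(\<lambda>n. (H (x + 1 / real (Suc n)) - H x) / (1 / real (Suc n))) \<longlonglongrightarrow> d x" by simp
      moreover have "\<forall>\<^sub>F n in sequentially. (H (x + 1 / real (Suc n)) - H x) / (1 / real (Suc n)) = q n x"
        using ev
      proof eventually_elim
        case (elim n)
        have "max a (min b (x + r)) = x + r" if "0 \<le> r" "r < b - x" for r using that x by auto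
        from this[OF _ elim] have "max a (min b (x + 1 / real (Suc n))) = x + 1 / real (Suc n)" by simp
        moreover have "max a (min b x) = x" using x by auto
        ultimately show ?case by (simp only: q_def T_def)
      qed
      ultimately show ?thesis using False by (simp add: Lim_transform_eventually)
    qed simp
  qed
  thus ?thesis
  proof (rule measurable_discrete_difference[where X = E'])
    show "countable E'" using E' by (rule countable_finite)
    show "{x} \<in> sets (lebesgue_on {a..b})" if "x \<in> E'" for x
      using that by (subst sets_restrict_space_iff) (auto simp: E'_def)
  qed auto
qed

lemma AE_lebesgue_on_except_finite:
  fixes E :: "real set"
  assumes "finite E" "\<And>x. x \<in> {a..b} - E \<Longrightarrow> P x"
  shows "AE x in lebesgue_on {a..b}. P x"
proof -
  have "AE x in lebesgue. x \<notin> E"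
    using assms(1) by (intro AE_not_in) (simp add: negligible_iff_null_sets[symmetric] negligible_finite)
  hence "AE x in lebesgue. x \<in> {a..b} \<longrightarrow> P x" by (rule AE_mp) (use assms(2) in auto)
  thus ?thesis by (subst AE_restrict_space_iff) auto
qed

section \<open>The system of marginal equations\<close>

lemma \<xi>_swap: "\<xi> g f y x = \<xi> f g x y"
  by (simp add: \<xi>_def mult.commute)

text \<open>The mixed second difference of \<open>x * y - f x - g y\<close> over a rectangle is its area, whatever \<open>f\<close>
  and \<open>g\<close> are, and the nonnegative values at two of the corners only diminish it.\<close>

lemma rectangle:
  assumes "0 \<le> \<xi> f g x' y" "0 \<le> \<xi> f g x y'"
    and "\<xi> f g x y \<le> M" "\<xi> f g x' y' \<le> M"
  shows "(x' - x) * (y' - y) \<le> 2 * M"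
proof -
  have "(x' - x) * (y' - y) = \<xi> f g x y + \<xi> f g x' y' - \<xi> f g x' y - \<xi> f g x y'"
    by (simp add: \<xi>_def algebra_simps)
  thus ?thesis using assms by linarith
qed

text \<open>The value is \<open>48 / (l * \<kappa> * \<beta>)\<close> for \<open>\<kappa> = l / (12 * L)\<close> and \<open>\<beta> = l * \<kappa> / (4 * L)\<close>, the numbers that
  appear in the proof of the width bound.\<close>

definition width_const :: "real \<Rightarrow> real \<Rightarrow> real" where
  "width_const l L = 27648 * L ^ 3 / l ^ 4"

text \<open>The derivative of a barycentre is the sum over the two ends of density times distance to the
  barycentre times speed, divided by the mass. The two constants insert the extreme values of these
  factors: density between \<open>l\<close> and \<open>L\<close>, distance between \<open>l / (2 * L) * h\<close> and \<open>h\<close>, mass between \<open>l * h\<close> and \<open>L * h\<close>, and speed between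
  \<open>l / (2 * L) / sqrt (K * L)\<close> (for an interior end) and \<open>L * K\<close>.\<close>

definition curvature_upper :: "real \<Rightarrow> real \<Rightarrow> real" where
  "curvature_upper l L = 2 * L\<^sup>2 * width_const l L / l"

definition curvature_lower :: "real \<Rightarrow> real \<Rightarrow> real" where
  "curvature_lower l L = l\<^sup>2 * (l / (2 * L) / sqrt (width_const l L * L)) / (2 * L\<^sup>2)"

text \<open>Only the marginal equations enter the analysis of the potentials, and they are symmetric: the two
  variables can be exchanged, and both can be reflected. So a fact proved for \<open>f\<close> holds
  for \<open>g\<close>, and a fact proved for the upper end of a section has a counterpart for the lower end.\<close>

locale qot_system =
  fixes l L \<epsilon> a0 b0 :: real and u0 f :: "real \<Rightarrow> real"
    and a1 b1 :: real and u1 g :: "real \<Rightarrow> real"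
  assumes l_pos: "0 < l" and \<epsilon>_pos: "0 < \<epsilon>"
    and lt0: "a0 < b0" and lt1: "a1 < b1"
    and cont_u0: "continuous_on {a0..b0} u0" and cont_u1: "continuous_on {a1..b1} u1"
    and cont_f: "continuous_on {a0..b0} f" and cont_g: "continuous_on {a1..b1} g"
    and u0_bounds: "\<And>x. x \<in> {a0..b0} \<Longrightarrow> l \<le> u0 x \<and> u0 x \<le> L"
    and u1_bounds: "\<And>y. y \<in> {a1..b1} \<Longrightarrow> l \<le> u1 y \<and> u1 y \<le> L"
    and marginal0: "\<And>x. x \<in> {a0..b0} \<Longrightarrow> integral {a1..b1} (\<lambda>y. max (\<xi> f g x y) 0 * u1 y) = \<epsilon>"
    and marginal1: "\<And>y. y \<in> {a1..b1} \<Longrightarrow> integral {a0..b0} (\<lambda>x. max (\<xi> f g x y) 0 * u0 x) = \<epsilon>"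
begin

lemma swapped: "qot_system l L \<epsilon> a1 b1 u1 g a0 b0 u0 f"
  by unfold_locales
    (use l_pos \<epsilon>_pos lt0 lt1 cont_u0 cont_u1 cont_f cont_g u0_bounds u1_bounds
      marginal0 marginal1 in \<open>auto simp: \<xi>_swap\<close>)

lemma reflected:
  "qot_system l L \<epsilon> (-b0) (-a0) (\<lambda>x. u0 (-x)) (\<lambda>x. f (-x)) (-b1) (-a1) (\<lambda>y. u1 (-y)) (\<lambda>y. g (-y))"
proof -
  have c: "continuous_on {-b..-a} (\<lambda>x. h (-x))" if "continuous_on {a..b} h"
    for a b and h :: "real \<Rightarrow> real"
    by (rule continuous_on_compose2[OF that]) (auto intro: continuous_intros)
  have s: "\<xi> (\<lambda>x. f (-x)) (\<lambda>y. g (-y)) x y = \<xi> f g (-x) (-y)" for x y by (simp add: \<xi>_def)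
  show ?thesis
  proof (unfold_locales, unfold s)
    fix x assume "x \<in> {-b0..-a0}"
    thus "integral {-b1..-a1} (\<lambda>y. max (\<xi> f g (-x) (-y)) 0 * u1 (-y)) = \<epsilon>"
      using Henstock_Kurzweil_Integration.integral_reflect_real
          [of b1 a1 "\<lambda>y. max (\<xi> f g (-x) y) 0 * u1 y"] marginal0[of "-x"] by simp
  next
    fix y assume "y \<in> {-b1..-a1}"
    thus "integral {-b0..-a0} (\<lambda>x. max (\<xi> f g (-x) (-y)) 0 * u0 (-x)) = \<epsilon>"
      using Henstock_Kurzweil_Integration.integral_reflect_real
          [of b0 a0 "\<lambda>x. max (\<xi> f g x (-y)) 0 * u0 x"] marginal1[of "-y"] by simp
  qed (use l_pos \<epsilon>_pos lt0 lt1 u0_bounds u1_bounds in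
      \<open>auto intro: c[OF cont_u0] c[OF cont_u1] c[OF cont_f] c[OF cont_g]\<close>)
qed

lemma l_le_L: "l \<le> L" using u0_bounds[of a0] lt0 by auto

lemma L_pos: "0 < L" using l_pos l_le_L by linarith

lemma u1_pos: "y \<in> {a1..b1} \<Longrightarrow> 0 < u1 y" using u1_bounds[of y] l_pos by linarith

lemma cont_\<xi>: "continuous_on {a1..b1} (\<xi> f g x)"
  unfolding \<xi>_def by (intro continuous_intros cont_g)

lemma cont_\<xi>_fst: "continuous_on {a0..b0} (\<lambda>x. \<xi> f g x y)"
  unfolding \<xi>_def by (intro continuous_intros cont_f)

lemma \<xi>_pos_exists:
  assumes "x \<in> {a0..b0}" shows "\<exists>y\<in>{a1..b1}. 0 < \<xi> f g x y"
proof (rule ccontr)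
  assume "\<not> ?thesis"
  hence "integral {a1..b1} (\<lambda>y. max (\<xi> f g x y) 0 * u1 y) = integral {a1..b1} (\<lambda>y. 0)"
    by (intro integral_cong) (auto simp: not_less max_absorb2)
  thus False using marginal0[OF assms] \<epsilon>_pos by simp
qed

text \<open>If \<open>f\<close> were above a chord at some point, the positive part of \<open>\<xi>\<close> there would lie below the convex
  combination of those at the ends of the chord, strictly somewhere, and could not have the same integral \<open>\<epsilon>\<close>.\<close>

lemma convex_f: "convex_on {a0..b0} f"
  unfolding convex_on_def
proof (intro conjI ballI allI impI)
  fix x x' :: real and s t :: real
  assume x: "x \<in> {a0..b0}" "x' \<in> {a0..b0}" and st: "0 \<le> s" "0 \<le> t" "s + t = 1"
  let ?z = "s *\<^sub>R x + t *\<^sub>R x'"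
  have z: "?z \<in> {a0..b0}" using x st by (meson convex_def convex_real_interval(5))
  show "f ?z \<le> s * f x + t * f x'"
  proof (rule ccontr)
    assume contra: "\<not> ?thesis"
    have conv: "\<xi> f g ?z y < s * \<xi> f g x y + t * \<xi> f g x' y" for y
    proof -
      have "s * g y + t * g y = g y" using st by (simp flip: distrib_right)
      thus ?thesis using contra by (simp add: \<xi>_def algebra_simps)
    qed
    let ?p = "\<lambda>y. max (\<xi> f g ?z y) 0"
    let ?q = "\<lambda>y. s * max (\<xi> f g x y) 0 + t * max (\<xi> f g x' y) 0"
    have le: "s * \<xi> f g x y + t * \<xi> f g x' y \<le> ?q y" for y
      using st by (intro add_mono mult_left_mono) auto
    obtain y0 where y0: "y0 \<in> {a1..b1}" "0 < \<xi> f g ?z y0"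
      using \<xi>_pos_exists[OF z] by blast
    have "integral {a1..b1} (\<lambda>y. ?p y * u1 y) < integral {a1..b1} (\<lambda>y. ?q y * u1 y)"
    proof (rule weighted_integral_strict_mono[OF lt1 _ _ cont_u1 u1_pos _ y0(1)])
      show "?p y \<le> ?q y" for y
        using conv[of y] le[of y] st by (auto simp: max_def)
      show "?p y0 < ?q y0"
        using conv[of y0] le[of y0] y0(2) by auto
    qed (intro continuous_intros cont_\<xi>)+
    also have "\<dots> = s * integral {a1..b1} (\<lambda>y. max (\<xi> f g x y) 0 * u1 y)
        + t * integral {a1..b1} (\<lambda>y. max (\<xi> f g x' y) 0 * u1 y)"
      by (simp add: distrib_right mult.assoc)
        (subst integral_add, auto intro!: integrable_continuous_interval continuous_intros cont_\<xi> cont_u1)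
    finally have "\<epsilon> < s * \<epsilon> + t * \<epsilon>" using marginal0[OF z] marginal0[OF x(1)] marginal0[OF x(2)] by simp
    moreover have "s * \<epsilon> + t * \<epsilon> = \<epsilon>" using st by (simp flip: distrib_right)
    ultimately show False by simp
  qed
qed simp

lemma convex_g: "convex_on {a1..b1} g"
proof -
  interpret sw: qot_system l L \<epsilon> a1 b1 u1 g a0 b0 u0 f by (rule swapped)
  show ?thesis by (rule sw.convex_f)
qed

lemma \<xi>_concave:
  assumes "y \<in> {a1..b1}" "y' \<in> {a1..b1}" "0 \<le> s" "0 \<le> t" "s + t = 1"
  shows "s * \<xi> f g x y + t * \<xi> f g x y' \<le> \<xi> f g x (s * y + t * y')"
proof -
  have "g (s * y + t * y') \<le> s * g y + t * g y'"
    using convex_g assms unfolding convex_on_def by auto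
  moreover have "s * f x + t * f x = f x" using assms by (simp flip: distrib_right)
  ultimately show ?thesis by (simp add: \<xi>_def algebra_simps)
qed

section \<open>Sections of the support\<close>

abbreviation "ym \<equiv> y_min {a1..b1} f g"
abbreviation "yM \<equiv> y_max {a1..b1} f g"

lemma section_interval:
  assumes x: "x \<in> {a0..b0}"
  shows "{y\<in>{a1..b1}. 0 \<le> \<xi> f g x y} = {ym x..yM x}" and "ym x \<le> yM x"
proof -
  let ?A = "{y\<in>{a1..b1}. 0 \<le> \<xi> f g x y}"
  have "?A = {a1..b1} \<inter> \<xi> f g x -` {0..}" by auto
  moreover have "closed ({a1..b1} \<inter> \<xi> f g x -` {0..})"
    by (rule continuous_closed_preimage[OF cont_\<xi>]) auto
  ultimately have "compact ?A"
    by (metis compact_Icc compact_Int_closed inf.left_idem)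
  moreover have "convex ?A"
    unfolding convex_def
  proof (intro ballI allI impI)
    fix y y' s t :: real
    assume h: "y \<in> ?A" "y' \<in> ?A" "0 \<le> s" "0 \<le> t" "s + t = 1"
    have "0 \<le> s * \<xi> f g x y + t * \<xi> f g x y'" using h by simp
    also have "\<dots> \<le> \<xi> f g x (s * y + t * y')" using h by (intro \<xi>_concave) auto
    finally show "s *\<^sub>R y + t *\<^sub>R y' \<in> ?A"
      using h convexD[OF convex_real_interval(5)[of a1 b1], of y y' s t] by auto
  qed
  hence "connected ?A" by (rule convex_connected)
  ultimately obtain p q where pq: "?A = {p..q}" using connected_compact_interval_1[of ?A] by auto
  moreover have "?A \<noteq> {}" using \<xi>_pos_exists[OF x] by (auto intro: less_imp_le)
  ultimately have "p \<le> q" by auto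
  hence "ym x = p" "yM x = q" unfolding y_min_def y_max_def pq by auto
  thus "?A = {ym x..yM x}" "ym x \<le> yM x" using pq \<open>p \<le> q\<close> by auto
qed

lemma in_section_iff:
  assumes "x \<in> {a0..b0}"
  shows "y \<in> {ym x..yM x} \<longleftrightarrow> y \<in> {a1..b1} \<and> 0 \<le> \<xi> f g x y"
  using section_interval(1)[OF assms] by blast

lemma section_subset:
  assumes "x \<in> {a0..b0}" shows "a1 \<le> ym x" "yM x \<le> b1" "{ym x..yM x} \<subseteq> {a1..b1}"
  using in_section_iff[OF assms, of "ym x"] in_section_iff[OF assms, of "yM x"] section_interval(2)[OF assms]
  by auto

lemma section_integral:
  assumes x: "x \<in> {a0..b0}"
  shows "integral {ym x..yM x} (\<lambda>y. \<xi> f g x y * u1 y) = \<epsilon>"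
proof -
  have "\<epsilon> = integral {a1..b1} (\<lambda>y. max (\<xi> f g x y) 0 * u1 y)" using marginal0[OF x] by simp
  also have "\<dots> = integral {ym x..yM x} (\<lambda>y. max (\<xi> f g x y) 0 * u1 y)"
    using section_subset[OF x] section_interval(2)[OF x] in_section_iff[OF x]
    by (intro integral_outside_zero) (auto simp: max_def)
  also have "\<dots> = integral {ym x..yM x} (\<lambda>y. \<xi> f g x y * u1 y)"
    using in_section_iff[OF x] by (intro integral_cong) auto
  finally show ?thesis by simp
qed

lemma section_nondegenerate:
  assumes x: "x \<in> {a0..b0}" shows "ym x < yM x"
proof -
  have "ym x \<noteq> yM x"
    using section_integral[OF x] \<epsilon>_pos by auto
  thus ?thesis using section_interval(2)[OF x] by simp
qed

text \<open>Were \<open>\<xi>\<close> positive at the end, the section would continue beyond it.\<close>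

lemma \<xi>_yM_zero:
  assumes x: "x \<in> {a0..b0}" and lt: "yM x < b1" shows "\<xi> f g x (yM x) = 0"
proof -
  have mem: "yM x \<in> {a1..b1}" "0 \<le> \<xi> f g x (yM x)"
    using in_section_iff[OF x, of "yM x"] section_interval(2)[OF x] by auto
  have "\<not> 0 < \<xi> f g x (yM x)"
  proof
    assume pos: "0 < \<xi> f g x (yM x)"
    have "((\<xi> f g x) \<longlongrightarrow> \<xi> f g x (yM x)) (at (yM x) within {a1..b1})"
      using cont_\<xi> mem(1) unfolding continuous_on_def by blast
    hence "\<forall>\<^sub>F y in at (yM x) within {a1..b1}. 0 < \<xi> f g x y"
      using pos by (rule order_tendstoD)
    then obtain d where d: "d > 0" "\<And>y. y \<in> {a1..b1} \<Longrightarrow> y \<noteq> yM x \<Longrightarrow> dist y (yM x) < d \<Longrightarrow> 0 < \<xi> f g x y"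
      unfolding eventually_at by blast
    let ?y = "min b1 (yM x + d / 2)"
    have "0 < \<xi> f g x ?y" using lt mem d(1) by (intro d(2)) (auto simp: dist_real_def min_def)
    hence "?y \<in> {ym x..yM x}" using lt mem d(1) by (subst in_section_iff[OF x]) auto
    thus False using lt d(1) by (auto simp: min_def split: if_splits)
  qed
  thus ?thesis using mem by simp
qed

section \<open>The derivative of a potential is a barycentre\<close>

definition mass :: "real \<Rightarrow> real" where "mass x = integral {ym x..yM x} u1"
definition moment :: "real \<Rightarrow> real" where "moment x = integral {ym x..yM x} (\<lambda>y. y * u1 y)"
definition bary :: "real \<Rightarrow> real" where "bary x = moment x / mass x"

lemma section_integrable:
  assumes "x \<in> {a0..b0}" "continuous_on {a1..b1} h"
  shows "(\<lambda>y. h y * u1 y) integrable_on {ym x..yM x}"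
  using assms section_subset[OF assms(1)]
  by (intro integrable_continuous_interval continuous_intros)
     (auto intro: continuous_on_subset cont_u1)

lemma mass_bounds:
  assumes x: "x \<in> {a0..b0}"
  shows "l * (yM x - ym x) \<le> mass x" "mass x \<le> L * (yM x - ym x)" "0 < mass x"
proof -
  have i: "u1 integrable_on {ym x..yM x}" using section_integrable[OF x, of "\<lambda>_. 1"] by simp
  have "integral {ym x..yM x} (\<lambda>_. l) \<le> mass x" unfolding mass_def
    using u1_bounds section_subset(3)[OF x] by (intro integral_le i) auto
  thus 1: "l * (yM x - ym x) \<le> mass x" using section_nondegenerate[OF x] by (simp add: mult.commute)
  have "mass x \<le> integral {ym x..yM x} (\<lambda>_. L)" unfolding mass_def
    using u1_bounds section_subset(3)[OF x] by (intro integral_le i) auto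
  thus "mass x \<le> L * (yM x - ym x)" using section_nondegenerate[OF x] by (simp add: mult.commute)
  have "0 < l * (yM x - ym x)" using l_pos section_nondegenerate[OF x] by simp
  thus "0 < mass x" using 1 by linarith
qed

text \<open>On the section at \<open>x\<close> the function \<open>\<xi>(x', \<cdot>)\<close> is at most its positive part, whose integral over
  \<open>[a1, b1]\<close> is \<open>\<epsilon>\<close>, while \<open>\<xi>(x, \<cdot>)\<close> integrates to exactly \<open>\<epsilon>\<close> there. The difference of the two
  functions is affine in \<open>y\<close>, so only the mass and the first moment of the section appear.\<close>

lemma bary_subgradient:
  assumes x: "x \<in> {a0..b0}" "x' \<in> {a0..b0}"
  shows "bary x * (x' - x) \<le> f x' - f x"
proof -
  let ?S = "{ym x..yM x}"
  have i: "(\<lambda>y. h y * u1 y) integrable_on ?S" if "continuous_on {a1..b1} h" for h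
    by (rule section_integrable[OF x(1) that])
  have "integral ?S (\<lambda>y. \<xi> f g x' y * u1 y) \<le> integral ?S (\<lambda>y. max (\<xi> f g x' y) 0 * u1 y)"
    using u1_pos section_subset(3)[OF x(1)]
    by (intro integral_le i cont_\<xi> continuous_intros) (auto intro!: mult_right_mono less_imp_le)
  also have "\<dots> \<le> integral {a1..b1} (\<lambda>y. max (\<xi> f g x' y) 0 * u1 y)"
    using u1_pos section_subset(3)[OF x(1)]
    by (intro integral_subset_le i cont_\<xi> continuous_intros integrable_continuous_interval cont_u1)
       (auto intro!: mult_nonneg_nonneg less_imp_le[of 0 "u1 _"])
  finally have upper: "integral ?S (\<lambda>y. \<xi> f g x' y * u1 y) \<le> \<epsilon>"
    using marginal0[OF x(2)] by simp
  have expand: "integral ?S (\<lambda>y. \<xi> f g x' y * u1 y)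
      = integral ?S (\<lambda>y. \<xi> f g x y * u1 y + ((x' - x) * (y * u1 y) - (f x' - f x) * u1 y))"
    by (intro integral_cong) (simp add: \<xi>_def algebra_simps)
  have int: "((\<lambda>y. \<xi> f g x y * u1 y + ((x' - x) * (y * u1 y) - (f x' - f x) * u1 y))
      has_integral (\<epsilon> + ((x' - x) * moment x - (f x' - f x) * mass x))) ?S"
  proof (intro has_integral_add has_integral_diff has_integral_mult_right)
    show "((\<lambda>y. \<xi> f g x y * u1 y) has_integral \<epsilon>) ?S"
      using i[OF cont_\<xi>] section_integral[OF x(1)] by (simp add: has_integral_iff)
    show "((\<lambda>y. y * u1 y) has_integral moment x) ?S"
      using i[OF continuous_on_id] by (simp add: has_integral_iff moment_def)
    show "(u1 has_integral mass x) ?S"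
      using i[of "\<lambda>_. 1"] by (simp add: has_integral_iff mass_def)
  qed
  from upper expand integral_unique[OF int] have "(x' - x) * moment x \<le> (f x' - f x) * mass x" by linarith
  thus ?thesis using mass_bounds(3)[OF x(1)] by (simp add: bary_def field_simps)
qed

text \<open>The distance from the end \<open>q\<close> to the barycentre, times the mass, is \<open>\<integral> (q - y) u1(y) dy \<ge> l * h\<^sup>2 / 2\<close>,
  and the mass is at most \<open>L * h\<close>.\<close>

lemma bary_bounds:
  assumes x: "x \<in> {a0..b0}"
  shows "l / (2 * L) * (yM x - ym x) \<le> yM x - bary x" "l / (2 * L) * (yM x - ym x) \<le> bary x - ym x"
proof -
  let ?p = "ym x" and ?q = "yM x"
  let ?S = "{?p..?q}"
  have pq: "?p < ?q" by (rule section_nondegenerate[OF x])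
  have key: "l / (2 * L) * (?q - ?p) \<le> m / mass x" if m: "l * (?q - ?p)\<^sup>2 / 2 \<le> m" for m
  proof -
    have "l / (2 * L) * (?q - ?p) * mass x \<le> l / (2 * L) * (?q - ?p) * (L * (?q - ?p))"
      using mass_bounds[OF x] pq l_pos L_pos by (intro mult_left_mono) auto
    also have "\<dots> = l * (?q - ?p)\<^sup>2 / 2" using L_pos by (simp add: power2_eq_square)
    also note m
    finally show ?thesis by (subst pos_le_divide_eq[OF mass_bounds(3)[OF x]])
  qed
  have id: "((\<lambda>y. y) has_integral (?q\<^sup>2 - ?p\<^sup>2) / 2) ?S" using pq by (intro ident_has_integral) simp
  have const: "((\<lambda>_. c) has_integral c * (?q - ?p)) ?S" for c
    using has_integral_const_real[of c ?p ?q] pq by (simp add: mult.commute)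
  have u: "(u1 has_integral mass x) ?S" "((\<lambda>y. y * u1 y) has_integral moment x) ?S"
    using section_integrable[OF x, of "\<lambda>_. 1"] section_integrable[OF x continuous_on_id]
    by (simp_all add: has_integral_iff mass_def moment_def)
  have u_ge: "l \<le> u1 y" if "y \<in> ?S" for y using u1_bounds section_subset(3)[OF x] that by blast
  have "l * (?q * (?q - ?p) - (?q\<^sup>2 - ?p\<^sup>2) / 2) \<le> ?q * mass x - moment x"
  proof (rule has_integral_le)
    show "((\<lambda>y. l * (?q - y)) has_integral l * (?q * (?q - ?p) - (?q\<^sup>2 - ?p\<^sup>2) / 2)) ?S"
      by (intro has_integral_mult_right has_integral_diff const id)
    show "((\<lambda>y. ?q * u1 y - y * u1 y) has_integral ?q * mass x - moment x) ?S"
      by (intro has_integral_mult_right has_integral_diff u)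
    show "l * (?q - y) \<le> ?q * u1 y - y * u1 y" if "y \<in> ?S" for y
      using mult_right_mono[OF u_ge[OF that], of "?q - y"] that by (simp add: algebra_simps)
  qed
  hence "l * (?q - ?p)\<^sup>2 / 2 \<le> ?q * mass x - moment x" by (simp add: power2_eq_square field_simps)
  from key[OF this] show "l / (2 * L) * (?q - ?p) \<le> ?q - bary x"
    using mass_bounds(3)[OF x] by (simp add: bary_def diff_divide_distrib)
  have "l * ((?q\<^sup>2 - ?p\<^sup>2) / 2 - ?p * (?q - ?p)) \<le> moment x - ?p * mass x"
  proof (rule has_integral_le)
    show "((\<lambda>y. l * (y - ?p)) has_integral l * ((?q\<^sup>2 - ?p\<^sup>2) / 2 - ?p * (?q - ?p))) ?S"
      by (intro has_integral_mult_right has_integral_diff const id)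
    show "((\<lambda>y. y * u1 y - ?p * u1 y) has_integral moment x - ?p * mass x) ?S"
      by (intro has_integral_mult_right has_integral_diff u)
    show "l * (y - ?p) \<le> y * u1 y - ?p * u1 y" if "y \<in> ?S" for y
      using mult_right_mono[OF u_ge[OF that], of "y - ?p"] that by (simp add: algebra_simps)
  qed
  hence "l * (?q - ?p)\<^sup>2 / 2 \<le> moment x - ?p * mass x" by (simp add: power2_eq_square field_simps)
  from key[OF this] show "l / (2 * L) * (?q - ?p) \<le> bary x - ?p"
    using mass_bounds(3)[OF x] by (simp add: bary_def diff_divide_distrib)
qed

lemma bary_in_section:
  assumes x: "x \<in> {a0..b0}" shows "ym x < bary x" "bary x < yM x"
proof -
  have "0 < l / (2 * L) * (yM x - ym x)" using section_nondegenerate[OF x] l_pos L_pos by simp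
  thus "ym x < bary x" "bary x < yM x" using bary_bounds[OF x] by linarith+
qed

text \<open>The secant slope of \<open>f\<close> up to \<open>x'\<close> is at most the barycentre at \<open>x'\<close>, hence below \<open>yM x'\<close>. Above that
  height \<open>\<xi>(\<cdot>, y)\<close> does not decrease from \<open>x\<close> to \<open>x'\<close>, so no point of the section at \<open>x\<close> can lie there.\<close>

lemma yM_mono:
  assumes x: "x \<in> {a0..b0}" "x' \<in> {a0..b0}" "x \<le> x'" shows "yM x \<le> yM x'"
proof (rule ccontr)
  assume contra: "\<not> ?thesis"
  hence "x < x'" using x(3) by (cases "x = x'") auto
  have q: "yM x \<in> {a1..b1}" "0 \<le> \<xi> f g x (yM x)"
    using in_section_iff[OF x(1), of "yM x"] section_interval(2)[OF x(1)] by auto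
  have "f x' - f x \<le> bary x' * (x' - x)" using bary_subgradient[OF x(2,1)] by (simp add: algebra_simps)
  also have "\<dots> \<le> yM x * (x' - x)"
    using bary_in_section(2)[OF x(2)] contra x(3) by (intro mult_right_mono) auto
  finally have "\<xi> f g x (yM x) \<le> \<xi> f g x' (yM x)" by (simp add: \<xi>_def algebra_simps)
  hence "yM x \<in> {ym x'..yM x'}" using q by (subst in_section_iff[OF x(2)]) auto
  thus False using contra by simp
qed

lemma reflected_sections:
  assumes "x \<in> {a0..b0}"
  shows "y_min {-b1..-a1} (\<lambda>x. f (-x)) (\<lambda>y. g (-y)) (-x) = - yM x"
    and "y_max {-b1..-a1} (\<lambda>x. f (-x)) (\<lambda>y. g (-y)) (-x) = - ym x"
proof -
  interpret rf: qot_system l L \<epsilon> "-b0" "-a0" "\<lambda>x. u0 (-x)" "\<lambda>x. f (-x)" "-b1" "-a1" "\<lambda>y. u1 (-y)" "\<lambda>y. g (-y)"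
    by (rule reflected)
  have mx: "- x \<in> {-b0..-a0}" using assms by simp
  have iff: "y \<in> {rf.ym (-x)..rf.yM (-x)} \<longleftrightarrow> - y \<in> {ym x..yM x}" for y
    unfolding rf.in_section_iff[OF mx] in_section_iff[OF assms] by (auto simp: \<xi>_def)
  have "rf.ym (-x) \<le> rf.yM (-x)" by (rule rf.section_interval(2)[OF mx])
  moreover have "ym x \<le> yM x" by (rule section_interval(2)[OF assms])
  ultimately have "rf.ym (-x) = - yM x \<and> rf.yM (-x) = - ym x"
    using iff[of "rf.ym (-x)"] iff[of "rf.yM (-x)"] iff[of "- ym x"] iff[of "- yM x"] by auto
  thus "rf.ym (-x) = - yM x" "rf.yM (-x) = - ym x" by auto
qed

lemma ym_mono:
  assumes x: "x \<in> {a0..b0}" "x' \<in> {a0..b0}" "x \<le> x'" shows "ym x \<le> ym x'"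
proof -
  interpret rf: qot_system l L \<epsilon> "-b0" "-a0" "\<lambda>x. u0 (-x)" "\<lambda>x. f (-x)" "-b1" "-a1" "\<lambda>y. u1 (-y)" "\<lambda>y. g (-y)"
    by (rule reflected)
  show ?thesis
    using rf.yM_mono[of "-x'" "-x"] reflected_sections(2)[OF x(1)] reflected_sections(2)[OF x(2)] x by auto
qed

lemma \<xi>_pos_eventually:
  assumes "x \<in> {a0..b0}" "0 < \<xi> f g x y"
  shows "\<forall>\<^sub>F x' in at x within {a0..b0}. 0 < \<xi> f g x' y"
  using order_tendstoD(1)[of "\<lambda>x. \<xi> f g x y"] cont_\<xi>_fst assms unfolding continuous_on_def by blast

lemma \<xi>_neg_eventually:
  assumes "x \<in> {a0..b0}" "\<xi> f g x y < 0"
  shows "\<forall>\<^sub>F x' in at x within {a0..b0}. \<xi> f g x' y < 0"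
  using order_tendstoD(2)[of "\<lambda>x. \<xi> f g x y"] cont_\<xi>_fst assms unfolding continuous_on_def by blast

text \<open>The end of the section is squeezed between heights at which \<open>\<xi>(x, \<cdot>)\<close> is strictly positive and
  strictly negative, and these signs persist for nearby \<open>x\<close>. Positive values arbitrarily close below the
  end exist by concavity.\<close>

lemma cont_yM: "continuous_on {a0..b0} yM"
  unfolding continuous_on_def
proof (intro ballI order_tendstoI)
  fix x c assume x: "x \<in> {a0..b0}"
  obtain z where z: "z \<in> {a1..b1}" "0 < \<xi> f g x z" using \<xi>_pos_exists[OF x] by blast
  hence z_sec: "z \<in> {ym x..yM x}" by (subst in_section_iff[OF x]) auto
  have q: "yM x \<in> {a1..b1}" "0 \<le> \<xi> f g x (yM x)"
    using in_section_iff[OF x, of "yM x"] section_interval(2)[OF x] by auto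
  {
    assume "c < yM x"
    have "\<exists>y\<in>{a1..b1}. c < y \<and> 0 < \<xi> f g x y"
    proof (cases "c < z")
      case True thus ?thesis using z by blast
    next
      case False
      (* between z and the end of the section, xi stays positive by concavity *)
      define t where "t = (yM x - (c + yM x) / 2) / (yM x - z)"
      have "t * (yM x - z) = yM x - (c + yM x) / 2" using False \<open>c < yM x\<close> by (simp add: t_def)
      moreover have "t * z + (1 - t) * yM x = yM x - t * (yM x - z)" by (simp add: algebra_simps)
      ultimately have "t * z + (1 - t) * yM x = (c + yM x) / 2" by simp
      moreover have "0 < t" "t \<le> 1"
        using False \<open>c < yM x\<close> unfolding t_def by (auto simp: field_simps)
      ultimately have t: "0 < t" "t \<le> 1" "t * z + (1 - t) * yM x = (c + yM x) / 2" by auto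
      have "0 < t * \<xi> f g x z + (1 - t) * \<xi> f g x (yM x)"
        using t q(2) z(2) by (intro add_pos_nonneg) auto
      also have "\<dots> \<le> \<xi> f g x (t * z + (1 - t) * yM x)"
        using t z q by (intro \<xi>_concave) auto
      finally have "0 < \<xi> f g x ((c + yM x) / 2)" using t by simp
      moreover have "(c + yM x) / 2 \<in> {a1..b1}" "c < (c + yM x) / 2"
        using False \<open>c < yM x\<close> z(1) q(1) by auto
      ultimately show ?thesis by blast
    qed
    then obtain y where y: "y \<in> {a1..b1}" "c < y" "0 < \<xi> f g x y" by blast
    show "\<forall>\<^sub>F x' in at x within {a0..b0}. c < yM x'"
      using \<xi>_pos_eventually[OF x y(3)] eventually_in_domain
    proof eventually_elim
      case (elim x')
      hence "y \<in> {ym x'..yM x'}" using y by (subst in_section_iff) auto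
      thus ?case using y by simp
    qed
  next
    assume c: "yM x < c"
    show "\<forall>\<^sub>F x' in at x within {a0..b0}. yM x' < c"
    proof (cases "c \<le> b1")
      case False
      show ?thesis using eventually_in_domain 
      proof eventually_elim
        case (elim x')
        thus ?case using section_subset(2)[OF elim] False by simp
      qed
    next
      case True
      hence c_in: "c \<in> {a1..b1}" using c q(1) by auto
      have "c \<notin> {ym x..yM x}" using c by auto
      hence "\<xi> f g x c < 0" using c_in in_section_iff[OF x, of c] by linarith
      from \<xi>_neg_eventually[OF x this] \<xi>_pos_eventually[OF x z(2)] eventually_in_domain
      show ?thesis
      proof eventually_elim
        case (elim x')
        have "z \<in> {ym x'..yM x'}" using elim z by (subst in_section_iff) auto
        moreover have "c \<notin> {ym x'..yM x'}" using elim by (subst in_section_iff) auto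
        ultimately show ?case using c z_sec by auto
      qed
    qed
  }
qed

lemma cont_ym: "continuous_on {a0..b0} ym"
proof -
  interpret rf: qot_system l L \<epsilon> "-b0" "-a0" "\<lambda>x. u0 (-x)" "\<lambda>x. f (-x)" "-b1" "-a1" "\<lambda>y. u1 (-y)" "\<lambda>y. g (-y)"
    by (rule reflected)
  have "continuous_on {a0..b0} (\<lambda>x. - rf.yM (-x))"
    by (intro continuous_on_minus continuous_on_compose2[OF rf.cont_yM])
       (auto intro: continuous_intros)
  thus ?thesis by (rule continuous_on_eq) (simp add: reflected_sections(2))
qed

lemma mass_moment_primitive:
  assumes x: "x \<in> {a0..b0}"
  shows "mass x = integral {a1..yM x} u1 - integral {a1..ym x} u1"
    and "moment x = integral {a1..yM x} (\<lambda>y. y * u1 y) - integral {a1..ym x} (\<lambda>y. y * u1 y)"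
proof -
  have "integral {a1..ym x} h + integral {ym x..yM x} h = integral {a1..yM x} h"
    if "continuous_on {a1..b1} h" for h :: "real \<Rightarrow> real"
    using section_subset[OF x] section_interval(2)[OF x] that
    by (intro Henstock_Kurzweil_Integration.integral_combine integrable_continuous_interval)
       (auto intro: continuous_on_subset)
  from this[OF cont_u1] this[OF continuous_on_mult[OF continuous_on_id cont_u1]]
  show "mass x = integral {a1..yM x} u1 - integral {a1..ym x} u1"
    and "moment x = integral {a1..yM x} (\<lambda>y. y * u1 y) - integral {a1..ym x} (\<lambda>y. y * u1 y)"
    unfolding mass_def moment_def by auto
qed

lemma cont_bary: "continuous_on {a0..b0} bary"
proof -
  have prim: "continuous_on {a1..b1} (\<lambda>y. integral {a1..y} h)" if "continuous_on {a1..b1} h" for h :: "real \<Rightarrow> real"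
    using that by (intro indefinite_integral_continuous_1 integrable_continuous_interval)
  have comp: "continuous_on {a0..b0} (\<lambda>x. integral {a1..k x} h)"
    if "continuous_on {a1..b1} h" "continuous_on {a0..b0} k" "k ` {a0..b0} \<subseteq> {a1..b1}" for h k :: "real \<Rightarrow> real"
    by (rule continuous_on_compose2[OF prim[OF that(1)] that(2,3)])
  have im: "yM ` {a0..b0} \<subseteq> {a1..b1}" "ym ` {a0..b0} \<subseteq> {a1..b1}"
    using section_subset section_interval(2) by fastforce+
  have yu: "continuous_on {a1..b1} (\<lambda>y. y * u1 y)" by (intro continuous_intros cont_u1)
  have "continuous_on {a0..b0} (\<lambda>x. (integral {a1..yM x} (\<lambda>y. y * u1 y) - integral {a1..ym x} (\<lambda>y. y * u1 y))
      / (integral {a1..yM x} u1 - integral {a1..ym x} u1))"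
    using mass_bounds(3) mass_moment_primitive(1)
    by (intro continuous_intros comp yu cont_u1 cont_yM cont_ym im) force+
  thus ?thesis by (rule continuous_on_eq) (simp add: bary_def mass_moment_primitive)
qed

text \<open>The difference quotient lies between the barycentres at the two points.\<close>

lemma f_has_derivative:
  assumes x: "x \<in> {a0..b0}" shows "(f has_real_derivative bary x) (at x within {a0..b0})"
proof -
  have "((\<lambda>x'. (f x' - f x) / (x' - x) - bary x) \<longlongrightarrow> 0) (at x within {a0..b0})"
  proof (rule Lim_null_comparison)
    show "\<forall>\<^sub>F x' in at x within {a0..b0}. norm ((f x' - f x) / (x' - x) - bary x) \<le> \<bar>bary x' - bary x\<bar>"
      unfolding eventually_at_filter
    proof (intro always_eventually allI impI)
      fix x' assume h: "x' \<noteq> x" "x' \<in> {a0..b0}"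
      let ?Q = "(f x' - f x) / (x' - x)"
      have s: "bary x * (x' - x) \<le> f x' - f x" "bary x' * (x - x') \<le> f x - f x'"
        using bary_subgradient x h by auto
      have "bary x \<le> ?Q \<and> ?Q \<le> bary x' \<or> bary x' \<le> ?Q \<and> ?Q \<le> bary x"
        using s h(1) by (cases "x < x'") (auto simp: field_simps)
      thus "norm (?Q - bary x) \<le> \<bar>bary x' - bary x\<bar>" by auto
    qed
    show "((\<lambda>x'. \<bar>bary x' - bary x\<bar>) \<longlongrightarrow> 0) (at x within {a0..b0})"
      using cont_bary x unfolding continuous_on_def by (auto intro!: tendsto_rabs_zero LIM_zero)
  qed
  thus ?thesis unfolding has_field_derivative_iff by (rule LIM_zero_cancel)
qed

section \<open>Height of the support function over a section\<close>

text \<open>By concavity, \<open>\<xi>(x, \<cdot>)\<close> keeps at least half of its value at \<open>y\<close> on the section shrunk by the factor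
  one half towards \<open>y\<close>.\<close>

lemma \<xi>_upper:
  assumes x: "x \<in> {a0..b0}" and y: "y \<in> {ym x..yM x}"
  shows "\<xi> f g x y * (l * (yM x - ym x)) \<le> 4 * \<epsilon>"
proof -
  let ?p = "ym x" and ?q = "yM x"
  let ?p' = "(?p + y) / 2" and ?q' = "(?q + y) / 2"
  have y': "y \<in> {a1..b1}" "0 \<le> \<xi> f g x y" using y in_section_iff[OF x] by blast+
  have sub: "{?p'..?q'} \<subseteq> {?p..?q}" using y by auto
  have half: "\<xi> f g x y / 2 \<le> \<xi> f g x z" if z: "z \<in> {?p'..?q'}" for z
  proof -
    (* z is the midpoint of y and a point of the section *)
    have "2 * z - y \<in> {?p..?q}" using z by auto
    hence w: "2 * z - y \<in> {a1..b1}" "0 \<le> \<xi> f g x (2 * z - y)" using in_section_iff[OF x] by blast+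
    have "1/2 * \<xi> f g x (2 * z - y) + 1/2 * \<xi> f g x y \<le> \<xi> f g x (1/2 * (2 * z - y) + 1/2 * y)"
      using w y' by (intro \<xi>_concave) auto
    moreover have "1/2 * (2 * z - y) + 1/2 * y = z" by (simp add: field_simps)
    ultimately have "1/2 * \<xi> f g x (2 * z - y) + 1/2 * \<xi> f g x y \<le> \<xi> f g x z" by metis
    thus ?thesis using w(2) by simp
  qed
  have cont: "continuous_on {?p..?q} (\<lambda>z. \<xi> f g x z * u1 z)"
    using section_subset(3)[OF x] by (intro continuous_intros) (auto intro: continuous_on_subset cont_\<xi> cont_u1)
  have "\<xi> f g x y / 2 * l * ((?q - ?p) / 2) = integral {?p'..?q'} (\<lambda>z. \<xi> f g x y / 2 * l)"
    using section_interval(2)[OF x] y by (simp add: field_simps)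
  also have "\<dots> \<le> integral {?p'..?q'} (\<lambda>z. \<xi> f g x z * u1 z)"
  proof (rule integral_le)
    show "(\<lambda>z. \<xi> f g x z * u1 z) integrable_on {?p'..?q'}"
      by (intro integrable_continuous_interval continuous_on_subset[OF cont sub])
    show "\<xi> f g x y / 2 * l \<le> \<xi> f g x z * u1 z" if z: "z \<in> {?p'..?q'}" for z
    proof (rule mult_mono[OF half[OF z]])
      show "l \<le> u1 z" using u1_bounds sub section_subset(3)[OF x] z by blast
      show "0 \<le> \<xi> f g x z" using half[OF z] y'(2) by linarith
    qed (use l_pos in simp)
  qed (intro integrable_continuous_interval continuous_intros)
  also have "\<dots> \<le> integral {?p..?q} (\<lambda>z. \<xi> f g x z * u1 z)"
  proof (rule integral_subset_le[OF sub])
    have "0 \<le> \<xi> f g x z * u1 z" if "z \<in> {?p..?q}" for z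
      using in_section_iff[OF x, of z] u1_pos[of z] that by simp
    thus "\<forall>z\<in>{?p..?q}. 0 \<le> \<xi> f g x z * u1 z" by blast
  qed (intro integrable_continuous_interval continuous_on_subset[OF cont] order_refl sub)+
  also have "\<dots> = \<epsilon>" by (rule section_integral[OF x])
  finally show ?thesis by (simp add: field_simps)
qed

lemma \<xi>_peak:
  assumes x: "x \<in> {a0..b0}"
  obtains y where "y \<in> {ym x..yM x}" "\<epsilon> \<le> L * (yM x - ym x) * \<xi> f g x y" "0 < \<xi> f g x y"
proof -
  let ?S = "{ym x..yM x}"
  have cont: "continuous_on ?S (\<xi> f g x)"
    using section_subset(3)[OF x] by (auto intro: continuous_on_subset cont_\<xi>)
  obtain y where y: "y \<in> ?S" "\<And>z. z \<in> ?S \<Longrightarrow> \<xi> f g x z \<le> \<xi> f g x y"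
    using continuous_attains_sup[OF compact_Icc _ cont] section_interval(2)[OF x] by auto
  have "\<epsilon> = integral ?S (\<lambda>z. \<xi> f g x z * u1 z)" by (rule section_integral[OF x, symmetric])
  also have "\<dots> \<le> integral ?S (\<lambda>_. \<xi> f g x y * L)"
  proof (rule integral_le)
    show "(\<lambda>z. \<xi> f g x z * u1 z) integrable_on ?S" by (rule section_integrable[OF x cont_\<xi>])
    show "\<xi> f g x z * u1 z \<le> \<xi> f g x y * L" if z: "z \<in> ?S" for z
      using y z u1_bounds[of z] l_pos in_section_iff[OF x] by (intro mult_mono) force+
  qed (intro integrable_continuous_interval continuous_intros)
  also have "\<dots> = L * (yM x - ym x) * \<xi> f g x y" using section_interval(2)[OF x] by simp
  finally have 1: "\<epsilon> \<le> L * (yM x - ym x) * \<xi> f g x y" .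
  have "0 < L * (yM x - ym x)" using L_pos section_nondegenerate[OF x] by simp
  hence "0 < \<xi> f g x y" using 1 \<epsilon>_pos by (meson less_le_trans zero_less_mult_pos)
  from that[OF y(1) 1 this] show thesis .
qed

section \<open>The width of the sections\<close>

lemma swapped_section_iff:
  assumes "y \<in> {a1..b1}"
  shows "x \<in> {y_min {a0..b0} g f y..y_max {a0..b0} g f y} \<longleftrightarrow> x \<in> {a0..b0} \<and> 0 \<le> \<xi> f g x y"
proof -
  interpret sw: qot_system l L \<epsilon> a1 b1 u1 g a0 b0 u0 f by (rule swapped)
  show ?thesis using sw.in_section_iff[OF assms] by (simp add: \<xi>_swap)
qed

text \<open>The plan carries the mass of \<open>\<mu>\<^sub>1\<close> on \<open>[y1, y2]\<close> over the \<open>x\<close>-sections of these points, which lie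
  between the lower end at \<open>y1\<close> and the upper end at \<open>y2\<close> by monotonicity; \<open>\<mu>\<^sub>0\<close> must have at least as
  much mass there.\<close>

lemma mass_balance:
  assumes y: "y1 \<in> {a1..b1}" "y2 \<in> {a1..b1}" "y1 \<le> y2"
  shows "l * (y2 - y1) \<le> L * (y_max {a0..b0} g f y2 - y_min {a0..b0} g f y1)"
proof -
  interpret sw: qot_system l L \<epsilon> a1 b1 u1 g a0 b0 u0 f by (rule swapped)
  let ?s = "sw.ym y1" and ?t = "sw.yM y2"
  have st: "a0 \<le> ?s" "?s \<le> ?t" "?t \<le> b0"
    using sw.section_interval(2)[OF y(1)] sw.yM_mono[OF y] sw.section_subset y by force+
  have sub: "{y1..y2} \<subseteq> {a1..b1}" using y by auto
  let ?k = "\<lambda>x y. max (\<xi> f g x y) 0 * u1 y * u0 x"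
  have "continuous_on ({a0..b0} \<times> {y1..y2}) (\<lambda>z. f (fst z))"
       "continuous_on ({a0..b0} \<times> {y1..y2}) (\<lambda>z. u0 (fst z))"
    by (rule continuous_on_compose2[OF cont_f], auto intro: continuous_intros)
       (rule continuous_on_compose2[OF cont_u0], auto intro: continuous_intros)
  moreover have "continuous_on ({a0..b0} \<times> {y1..y2}) (\<lambda>z. g (snd z))"
       "continuous_on ({a0..b0} \<times> {y1..y2}) (\<lambda>z. u1 (snd z))"
    using y by (rule_tac continuous_on_compose2[OF cont_g], auto intro: continuous_intros)
       (rule_tac continuous_on_compose2[OF cont_u1], use y in \<open>auto intro: continuous_intros\<close>)
  ultimately have cont: "continuous_on ({a0..b0} \<times> {y1..y2}) (\<lambda>(x, y). ?k x y)"
    unfolding case_prod_unfold \<xi>_def by (intro continuous_intros)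
  have cont': "continuous_on (cbox (a0, y1) (b0, y2)) (\<lambda>(x, y). ?k x y)"
    using cont by (simp add: cbox_Pair_eq)
  let ?h = "\<lambda>x. integral {y1..y2} (?k x)"
  have cont_h: "continuous_on {a0..b0} ?h"
    using integral_continuous_on_param[of "{a0..b0}" y1 y2 ?k] cont by simp
  have "l * (y2 - y1) * \<epsilon> = integral {y1..y2} (\<lambda>_. l * \<epsilon>)" using y by simp
  also have "\<dots> \<le> integral {y1..y2} (\<lambda>y. u1 y * \<epsilon>)"
    using u1_bounds sub \<epsilon>_pos
    by (intro integral_le integrable_continuous_interval continuous_intros continuous_on_subset[OF cont_u1])
       (auto intro!: mult_right_mono)
  also have "\<dots> = integral {y1..y2} (\<lambda>y. integral {a0..b0} (\<lambda>x. ?k x y))"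
  proof (rule integral_cong)
    fix y assume "y \<in> {y1..y2}"
    hence "y \<in> {a1..b1}" using sub by blast
    from marginal1[OF this]
    have "u1 y * \<epsilon> = u1 y * integral {a0..b0} (\<lambda>x. max (\<xi> f g x y) 0 * u0 x)" by simp
    also have "\<dots> = integral {a0..b0} (\<lambda>x. u1 y * (max (\<xi> f g x y) 0 * u0 x))"
      by (rule integral_mult_right[symmetric])
    finally show "u1 y * \<epsilon> = integral {a0..b0} (\<lambda>x. ?k x y)" by (simp add: mult_ac)
  qed
  also have "\<dots> = integral {a0..b0} ?h"
    using integral_swap_continuous[OF cont'] by simp
  also have "\<dots> = integral {?s..?t} ?h"
  proof (rule integral_outside_zero[OF st])
    fix x assume x: "x \<in> {a0..b0}" "x \<notin> {?s..?t}"
    have "?k x y = 0" if yy: "y \<in> {y1..y2}" for y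
    proof -
      have y': "y \<in> {a1..b1}" using sub yy by blast
      have "?s \<le> sw.ym y" "sw.yM y \<le> ?t"
        using sw.ym_mono[of y1 y] sw.yM_mono[of y y2] y y' yy by auto
      hence "x \<notin> {sw.ym y..sw.yM y}" using x(2) by auto
      hence "\<xi> f g x y < 0" using swapped_section_iff[OF y', of x] x(1) by linarith
      thus ?thesis by simp
    qed
    hence "?h x = integral {y1..y2} (\<lambda>_. 0)" by (intro integral_cong)
    thus "?h x = 0" by simp
  qed
  also have "\<dots> \<le> integral {?s..?t} (\<lambda>_. L * \<epsilon>)"
  proof (rule integral_le)
    have s': "{?s..?t} \<subseteq> {a0..b0}" using st by auto
    show "?h integrable_on {?s..?t}"
      by (intro integrable_continuous_interval continuous_on_subset[OF cont_h s'])
    fix x assume "x \<in> {?s..?t}"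
    hence x: "x \<in> {a0..b0}" using s' by blast
    have k: "continuous_on {a1..b1} (\<lambda>y. max (\<xi> f g x y) 0 * u1 y)"
      by (intro continuous_intros cont_\<xi> cont_u1)
    have "integral {y1..y2} (\<lambda>y. max (\<xi> f g x y) 0 * u1 y) \<le> integral {a1..b1} (\<lambda>y. max (\<xi> f g x y) 0 * u1 y)"
      using u1_pos by (intro integral_subset_le[OF sub] integrable_continuous_interval k continuous_on_subset[OF k sub])
        (auto intro!: mult_nonneg_nonneg less_imp_le[of 0 "u1 _"])
    hence "integral {y1..y2} (\<lambda>y. max (\<xi> f g x y) 0 * u1 y) \<le> \<epsilon>" using marginal0[OF x] by simp
    moreover have "?h x = integral {y1..y2} (\<lambda>y. max (\<xi> f g x y) 0 * u1 y) * u0 x"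
      by (rule integral_mult_left)
    ultimately show "?h x \<le> L * \<epsilon>"
      using u0_bounds[OF x] l_pos \<epsilon>_pos L_pos
        mult_mono[of "integral {y1..y2} (\<lambda>y. max (\<xi> f g x y) 0 * u1 y)" \<epsilon> "u0 x" L]
      by (simp add: mult.commute)
  qed (intro integrable_continuous_interval continuous_intros)
  also have "\<dots> = L * (?t - ?s) * \<epsilon>" using st by simp
  finally show ?thesis using \<epsilon>_pos by simp
qed

abbreviation "K \<equiv> width_const l L"

lemma K_pos: "0 < K" using l_pos L_pos by (simp add: width_const_def)

text \<open>By exchange of the variables this is the barycentre of \<open>\<mu>\<^sub>0\<close> on the \<open>x\<close>-section over a point, and
  the derivative of \<open>g\<close>.\<close>

abbreviation "xbary \<equiv> qot_system.bary g a0 b0 u0 f"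

text \<open>Over the middle half of a section, a concave function that is nonnegative on the whole section has
  slope at most its height divided by \<open>h / 4\<close>. Here the slope is \<open>x - g' y\<close>.\<close>

lemma barycentre_near:
  fixes x :: real
  defines "h \<equiv> yM x - ym x"
  assumes x: "x \<in> {a0..b0}" and y: "ym x + h / 4 \<le> y" "y \<le> yM x - h / 4"
  shows "\<bar>xbary y - x\<bar> \<le> 16 * \<epsilon> / (l * h\<^sup>2)"
proof -
  interpret sw: qot_system l L \<epsilon> a1 b1 u1 g a0 b0 u0 f by (rule swapped)
  have h: "0 < h" using section_nondegenerate[OF x] by (simp add: h_def)
  have y_sec: "y \<in> {ym x..yM x}" using y h by auto
  hence y1: "y \<in> {a1..b1}" "0 \<le> \<xi> f g x y" using in_section_iff[OF x] by blast+
  have M: "\<xi> f g x y \<le> 4 * \<epsilon> / (l * h)"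
    using \<xi>_upper[OF x y_sec] l_pos h by (simp add: h_def pos_le_divide_eq)
  have ends: "ym x \<in> {a1..b1}" "0 \<le> \<xi> f g x (ym x)" "yM x \<in> {a1..b1}" "0 \<le> \<xi> f g x (yM x)"
    using in_section_iff[OF x, of "yM x"] in_section_iff[OF x, of "ym x"] section_interval(2)[OF x] by auto
  have *: "(x - xbary y) * (z - y) \<ge> - (4 * \<epsilon> / (l * h))" if "z \<in> {a1..b1}" "0 \<le> \<xi> f g x z" for z
    using sw.bary_subgradient[OF y1(1) that(1)] that(2) M by (simp add: \<xi>_def algebra_simps)
  have scale: "16 * \<epsilon> / (l * h\<^sup>2) * (h / 4) = 4 * \<epsilon> / (l * h)"
    using h by (simp add: power2_eq_square)
  let ?\<delta> = "16 * \<epsilon> / (l * h\<^sup>2)"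
  have \<delta>: "0 \<le> ?\<delta>" using \<epsilon>_pos l_pos by simp
  have "xbary y - x \<le> ?\<delta>"
  proof (rule ccontr)
    assume c: "\<not> ?thesis"
    have "?\<delta> * (h / 4) < (xbary y - x) * (h / 4)" using c h by (intro mult_strict_right_mono) auto
    also have "\<dots> \<le> (xbary y - x) * (yM x - y)" using c y \<delta> by (intro mult_left_mono) auto
    finally show False using *[OF ends(3,4)] scale by (simp add: algebra_simps)
  qed
  moreover have "x - xbary y \<le> ?\<delta>"
  proof (rule ccontr)
    assume c: "\<not> ?thesis"
    have "?\<delta> * (h / 4) < (x - xbary y) * (h / 4)" using c h by (intro mult_strict_right_mono) auto
    also have "\<dots> \<le> (x - xbary y) * (y - ym x)" using c y \<delta> by (intro mult_left_mono) auto
    finally show False using *[OF ends(1,2)] scale by (simp add: algebra_simps)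
  qed
  ultimately show ?thesis by linarith
qed

text \<open>If the slope bound over the middle half is small against \<open>h\<close>, there is a large rectangle. The points \<open>j 0, \<dots>, j 3\<close> cut the middle half of the
  section into three equal parts, \<open>\<kappa> * h\<close> is the extent that the mass balance forces on one side of \<open>x\<close>,
  and \<open>\<beta> * h\<close> is the extent that the balance of the barycentre then forces on the other side. Two
  consecutive points and this last length make the rectangle.\<close>

lemma section_width:
  assumes x: "x \<in> {a0..b0}" shows "(yM x - ym x) ^ 3 \<le> K * \<epsilon>"
proof -
  interpret sw: qot_system l L \<epsilon> a1 b1 u1 g a0 b0 u0 f by (rule swapped)
  define h where "h = yM x - ym x"
  have h: "0 < h" using section_nondegenerate[OF x] by (simp add: h_def)
  define \<kappa> where "\<kappa> = l / (12 * L)"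
  define \<beta> where "\<beta> = l / (4 * L) * \<kappa>"
  have pos: "0 < \<kappa>" "0 < \<beta>" using l_pos L_pos by (auto simp: \<kappa>_def \<beta>_def)
  have \<kappa>1: "\<kappa> \<le> 1" using l_le_L L_pos by (simp add: \<kappa>_def)
  define j where "j k = ym x + h / 4 + k * (h / 6)" for k :: real
  have K1: "K = 48 / (l * \<kappa> * \<beta>)" and K2: "16 / (l * \<beta>) \<le> K"
  proof -
    show K1: "K = 48 / (l * \<kappa> * \<beta>)"
      using l_pos L_pos by (simp add: width_const_def \<kappa>_def \<beta>_def field_simps power3_eq_cube power4_eq_xxxx)
    have "16 / (l * \<beta>) * \<kappa> \<le> 48 / (l * \<beta>)"
      using \<kappa>1 pos l_pos mult_left_mono[of \<kappa> 1 "16 / (l * \<beta>)"] by (simp add: divide_right_mono field_simps)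
    thus "16 / (l * \<beta>) \<le> K" using pos l_pos unfolding K1 by (simp add: field_simps)
  qed
  (* if the slope bound is not small against h, the claim holds outright *)
  show ?thesis
  proof (cases "16 * \<epsilon> / (l * h\<^sup>2) \<le> \<beta> * h")
    case False
    hence "\<beta> * h * (l * h\<^sup>2) < 16 * \<epsilon>" using l_pos h by (simp add: pos_less_divide_eq not_le)
    hence "h ^ 3 \<le> 16 / (l * \<beta>) * \<epsilon>" using l_pos pos by (simp add: field_simps power3_eq_cube power2_eq_square)
    also have "\<dots> \<le> K * \<epsilon>" using K2 \<epsilon>_pos by (intro mult_right_mono) auto
    finally show ?thesis by (simp add: h_def)
  next
    case True
    have j: "ym x + h / 4 \<le> j k" "j k \<le> yM x - h / 4" if "0 \<le> k" "k \<le> 3" for k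
    proof -
      have "0 \<le> k * (h / 6)" "k * (h / 6) \<le> 3 * (h / 6)" using that h by (auto intro: mult_right_mono)
      thus "ym x + h / 4 \<le> j k" "j k \<le> yM x - h / 4" by (auto simp: j_def h_def field_simps)
    qed
    have jY: "j k \<in> {a1..b1}" and xT: "x \<in> {sw.ym (j k)..sw.yM (j k)}" if "0 \<le> k" "k \<le> 3" for k
    proof -
      have "j k \<in> {ym x..yM x}" using j[OF that] h by auto
      hence "j k \<in> {a1..b1} \<and> 0 \<le> \<xi> f g x (j k)" using in_section_iff[OF x] by blast
      thus "j k \<in> {a1..b1}" "x \<in> {sw.ym (j k)..sw.yM (j k)}"
        using swapped_section_iff x by blast+
    qed
    have near: "\<bar>xbary (j k) - x\<bar> \<le> \<beta> * h" if "0 \<le> k" "k \<le> 3" for k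
      using barycentre_near[OF x, of "j k"] j[OF that] True unfolding h_def by linarith
    have spread: "\<kappa> * h \<le> c \<Longrightarrow> 2 * (\<beta> * h) \<le> l / (2 * L) * c" for c
    proof -
      assume "\<kappa> * h \<le> c"
      hence "l / (2 * L) * (\<kappa> * h) \<le> l / (2 * L) * c" using l_pos L_pos by (intro mult_left_mono) auto
      moreover have "l / (2 * L) * (\<kappa> * h) = 2 * (\<beta> * h)" by (simp add: \<beta>_def)
      ultimately show ?thesis by simp
    qed
    have left: "x - \<beta> * h \<in> {sw.ym (j k)..sw.yM (j k)}"
      if k: "0 \<le> k" "k \<le> 3" and wide: "\<kappa> * h \<le> sw.yM (j k) - x" for k
    proof -
      have "2 * (\<beta> * h) \<le> l / (2 * L) * (sw.yM (j k) - sw.ym (j k))"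
        using wide xT[OF k] by (intro spread) auto
      also have "\<dots> \<le> xbary (j k) - sw.ym (j k)" by (rule sw.bary_bounds(2)[OF jY[OF k]])
      finally have "sw.ym (j k) \<le> x - \<beta> * h" using near[OF k] by linarith
      moreover have "0 \<le> \<beta> * h" using pos h by simp
      ultimately show ?thesis using xT[OF k] by auto
    qed
    have right: "x + \<beta> * h \<in> {sw.ym (j k)..sw.yM (j k)}"
      if k: "0 \<le> k" "k \<le> 3" and wide: "\<kappa> * h \<le> x - sw.ym (j k)" for k
    proof -
      have "2 * (\<beta> * h) \<le> l / (2 * L) * (sw.yM (j k) - sw.ym (j k))"
        using wide xT[OF k] by (intro spread) auto
      also have "\<dots> \<le> sw.yM (j k) - xbary (j k)" by (rule sw.bary_bounds(1)[OF jY[OF k]])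
      finally have "x + \<beta> * h \<le> sw.yM (j k)" using near[OF k] by linarith
      moreover have "0 \<le> \<beta> * h" using pos h by simp
      ultimately show ?thesis using xT[OF k] by auto
    qed
    have upper: "\<xi> f g z (j k) \<le> 4 * \<epsilon> / (l * (\<kappa> * h))"
      if k: "0 \<le> k" "k \<le> 3" and z: "z \<in> {sw.ym (j k)..sw.yM (j k)}"
        and wide: "\<kappa> * h \<le> sw.yM (j k) - sw.ym (j k)" for z k
    proof -
      have "0 \<le> \<xi> f g z (j k)" using z swapped_section_iff[OF jY[OF k]] by blast
      hence "\<xi> f g z (j k) * (l * (\<kappa> * h)) \<le> \<xi> f g z (j k) * (l * (sw.yM (j k) - sw.ym (j k)))"
        using wide l_pos by (intro mult_left_mono) auto
      also have "\<dots> \<le> 4 * \<epsilon>" using sw.\<xi>_upper[OF jY[OF k] z] by (simp add: \<xi>_swap)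
      finally show ?thesis using l_pos pos h by (simp add: pos_le_divide_eq)
    qed
    (* the rectangle with corners z, z' and two consecutive points j k, j (k + 1) *)
    have finish: "h ^ 3 \<le> K * \<epsilon>"
      if k: "0 \<le> k" "k + 1 \<le> 3"
        and wide: "\<kappa> * h \<le> sw.yM (j k) - sw.ym (j k)" "\<kappa> * h \<le> sw.yM (j (k + 1)) - sw.ym (j (k + 1))"
        and z: "z' - z = \<beta> * h"
          "z \<in> {sw.ym (j k)..sw.yM (j k)}" "z' \<in> {sw.ym (j k)..sw.yM (j k)}"
          "z \<in> {sw.ym (j (k+1))..sw.yM (j (k+1))}" "z' \<in> {sw.ym (j (k+1))..sw.yM (j (k+1))}" for k z z'
    proof -
      have k': "k \<le> 3" "0 \<le> k + 1" using k by auto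
      note zi = z(2,3)[unfolded swapped_section_iff[OF jY[OF k(1) k'(1)]]]
        z(4,5)[unfolded swapped_section_iff[OF jY[OF k'(2) k(2)]]]
      have "(z' - z) * (j (k + 1) - j k) \<le> 2 * (4 * \<epsilon> / (l * (\<kappa> * h)))"
        using rectangle[OF _ _ upper[OF k(1) k'(1) z(2) wide(1)] upper[OF k'(2) k(2) z(5) wide(2)]] zi
        by blast
      moreover have "j (k + 1) - j k = h / 6" by (simp add: j_def algebra_simps)
      ultimately have "\<beta> * h * (h / 6) \<le> 2 * (4 * \<epsilon> / (l * (\<kappa> * h)))" using z(1) by simp
      hence "\<beta> * h * (h / 6) * (l * (\<kappa> * h)) \<le> 8 * \<epsilon>"
        using l_pos pos h by (simp add: pos_le_divide_eq)
      thus ?thesis using l_pos pos unfolding K1 by (simp add: field_simps power3_eq_cube)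
    qed
    have "l * (j 2 - j 1) \<le> L * (sw.yM (j 2) - sw.ym (j 1))"
      using h by (intro mass_balance jY) (auto simp: j_def)
    moreover have "j 2 - j 1 = h / 6" by (simp add: j_def algebra_simps)
    ultimately have "2 * (\<kappa> * h) \<le> sw.yM (j 2) - sw.ym (j 1)"
      using L_pos by (simp add: \<kappa>_def field_simps)
    (* an extent of 2 * \<kappa> * h leaves \<kappa> * h on one side of x; monotonicity of the ends passes it
       on to the next point outwards, j 3 or j 0 *)
    then consider "\<kappa> * h \<le> sw.yM (j 2) - x" | "\<kappa> * h \<le> x - sw.ym (j 1)" by linarith
    thus ?thesis
    proof cases
      case 1
      have "sw.yM (j 2) \<le> sw.yM (j 3)" using h by (intro sw.yM_mono jY) (auto simp: j_def)
      hence w: "\<kappa> * h \<le> sw.yM (j 3) - x" using 1 by linarith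
      have "h ^ 3 \<le> K * \<epsilon>"
      proof (rule finish[of 2 x "x - \<beta> * h"])
        show "\<kappa> * h \<le> sw.yM (j 2) - sw.ym (j 2)" using 1 xT[of 2] by auto
        show "\<kappa> * h \<le> sw.yM (j (2 + 1)) - sw.ym (j (2 + 1))" using w xT[of 3] by auto
      qed (use xT[of 2] xT[of 3] left[of 2] left[of 3] 1 w in auto)
      thus ?thesis by (simp add: h_def)
    next
      case 2
      have "sw.ym (j 0) \<le> sw.ym (j 1)" using h by (intro sw.ym_mono jY) (auto simp: j_def)
      hence w: "\<kappa> * h \<le> x - sw.ym (j 0)" using 2 by linarith
      have "h ^ 3 \<le> K * \<epsilon>"
      proof (rule finish[of 0 "x + \<beta> * h" x])
        show "\<kappa> * h \<le> sw.yM (j 0) - sw.ym (j 0)" using w xT[of 0] by auto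
        show "\<kappa> * h \<le> sw.yM (j (0 + 1)) - sw.ym (j (0 + 1))" using 2 xT[of 1] by auto
      qed (use xT[of 0] xT[of 1] right[of 0] right[of 1] 2 w in auto)
      thus ?thesis by (simp add: h_def)
    qed
  qed
qed

section \<open>Speed of the ends of a section\<close>

text \<open>The first bound compares the slope at the end with the peak of \<open>\<xi>(x, \<cdot>)\<close>, which has height at least
  \<open>\<epsilon> / (L * h)\<close>. The last one also uses that both \<open>x\<close> and the barycentre \<open>g'(yM x)\<close> lie in the \<open>x\<close>-section
  over \<open>yM x\<close>, whose width is known.\<close>

lemma end_slope:
  assumes x: "x \<in> {a0..b0}" and q: "yM x < b1"
  shows "\<epsilon> \<le> L * (yM x - ym x)\<^sup>2 * (xbary (yM x) - x)" "0 < xbary (yM x) - x"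
    "(xbary (yM x) - x)\<^sup>2 \<le> K * L * (yM x - ym x)\<^sup>2"
proof -
  interpret sw: qot_system l L \<epsilon> a1 b1 u1 g a0 b0 u0 f by (rule swapped)
  let ?q = "yM x" and ?h = "yM x - ym x" and ?s = "xbary (yM x) - x"
  have h: "0 < ?h" using section_nondegenerate[OF x] by simp
  have q1: "?q \<in> {a1..b1}" "\<xi> f g x ?q = 0"
    using section_subset[OF x] section_interval(2)[OF x] \<xi>_yM_zero[OF x q] by auto
  obtain y where y: "y \<in> {ym x..?q}" "\<epsilon> \<le> L * ?h * \<xi> f g x y" "0 < \<xi> f g x y" by (rule \<xi>_peak[OF x])
  have y1: "y \<in> {a1..b1}" using y(1) in_section_iff[OF x] by blast
  have 1: "\<xi> f g x y \<le> ?s * (?q - y)"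
    using sw.bary_subgradient[OF q1(1) y1] q1(2) by (simp add: \<xi>_def algebra_simps)
  show s: "0 < ?s"
  proof (rule ccontr)
    assume "\<not> 0 < ?s"
    hence "?s * (?q - y) \<le> 0" using y(1) by (intro mult_nonpos_nonneg) auto
    thus False using 1 y(3) by linarith
  qed
  (* y is the peak, so the height of the peak is at most the slope at the end times h *)
  have "?s * (?q - y) \<le> ?s * ?h" using y(1) s by (intro mult_left_mono) auto
  hence "L * ?h * \<xi> f g x y \<le> L * ?h * (?s * ?h)"
    using 1 L_pos h by (intro mult_left_mono) auto
  thus 2: "\<epsilon> \<le> L * ?h\<^sup>2 * ?s" using y(2) by (simp add: power2_eq_square algebra_simps)
  have "x \<in> {sw.ym ?q..sw.yM ?q}" using q1 x by (subst swapped_section_iff) auto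
  hence "?s \<le> sw.yM ?q - sw.ym ?q" using sw.bary_in_section[OF q1(1)] by auto
  hence "?s ^ 3 \<le> (sw.yM ?q - sw.ym ?q) ^ 3" using s by (intro power_mono) auto
  also have "\<dots> \<le> K * \<epsilon>" by (rule sw.section_width[OF q1(1)])
  also have "\<dots> \<le> K * (L * ?h\<^sup>2 * ?s)" using 2 K_pos by (intro mult_left_mono) auto
  finally have "?s * ?s\<^sup>2 \<le> ?s * (K * L * ?h\<^sup>2)" by (simp add: power3_eq_cube power2_eq_square algebra_simps)
  thus "?s\<^sup>2 \<le> K * L * ?h\<^sup>2" using s by simp
qed

text \<open>Implicit differentiation of \<open>\<xi>(x, yM x) = 0\<close>, with the increments of \<open>f\<close> and \<open>g\<close> written through
  Caratheodory's continuous difference quotients, so that a vanishing increment of \<open>yM\<close> needs no separate case.\<close>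

lemma yM_derivative_interior:
  assumes x: "x \<in> {a0..b0}" and q: "yM x < b1"
  shows "(yM has_real_derivative (yM x - bary x) / (xbary (yM x) - x)) (at x within {a0..b0})"
proof -
  interpret sw: qot_system l L \<epsilon> a1 b1 u1 g a0 b0 u0 f by (rule swapped)
  let ?q = "yM x" and ?X = "{a0..b0}" and ?Y = "{a1..b1}"
  have qY: "?q \<in> ?Y" using section_subset[OF x] section_interval(2)[OF x] by auto
  obtain \<phi> where \<phi>: "\<And>z. f z - f x = \<phi> z * (z - x)" "continuous (at x within ?X) \<phi>" "\<phi> x = bary x"
    using f_has_derivative[OF x] unfolding DERIV_caratheodory_within by blast
  obtain \<gamma> where \<gamma>: "\<And>z. g z - g ?q = \<gamma> z * (z - ?q)" "continuous (at ?q within ?Y) \<gamma>" "\<gamma> ?q = xbary ?q"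
    using sw.f_has_derivative[OF qY] unfolding DERIV_caratheodory_within by blast
  have im: "yM ` ?X \<subseteq> ?Y" using section_subset section_interval(2) by fastforce
  have cyM: "continuous (at x within ?X) yM" using cont_yM x by (simp add: continuous_on_eq_continuous_within)
  have "continuous (at x within ?X) (\<lambda>x'. \<gamma> (yM x'))"
    by (rule continuous_within_compose2[OF cyM continuous_within_subset[OF \<gamma>(2) im]])
  hence k: "((\<lambda>x'. \<gamma> (yM x') - x) \<longlongrightarrow> xbary ?q - x) (at x within ?X)"
    using \<gamma>(3) by (auto simp: continuous_within intro!: tendsto_diff)
  have num: "((\<lambda>x'. yM x' - \<phi> x') \<longlongrightarrow> ?q - bary x) (at x within ?X)"
    using cyM \<phi>(2,3) by (auto simp: continuous_within intro!: tendsto_diff)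
  have s: "0 < xbary ?q - x" by (rule end_slope(2)[OF x q])
  have lim: "((\<lambda>x'. (yM x' - \<phi> x') / (\<gamma> (yM x') - x)) \<longlongrightarrow> (?q - bary x) / (xbary ?q - x)) (at x within ?X)"
    using s by (intro tendsto_divide num k) auto
  have ev: "\<forall>\<^sub>F x' in at x within ?X. yM x' < b1"
    using cyM q unfolding continuous_within by (rule order_tendstoD(2))
  have "\<forall>\<^sub>F x' in at x within ?X. x' \<noteq> x" by (simp add: eventually_at_filter)
  from ev order_tendstoD(1)[OF k s] eventually_in_domain this
  have "\<forall>\<^sub>F x' in at x within ?X. (yM x' - \<phi> x') / (\<gamma> (yM x') - x) = (yM x' - ?q) / (x' - x)"
  proof eventually_elim
    case (elim x')
    have "\<xi> f g x' (yM x') = 0" "\<xi> f g x ?q = 0" using \<xi>_yM_zero elim q x by auto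
    hence "(x' - x) * yM x' + x * (yM x' - ?q) - (f x' - f x) - (g (yM x') - g ?q) = 0"
      by (simp add: \<xi>_def algebra_simps)
    hence "(yM x' - ?q) * (\<gamma> (yM x') - x) = (x' - x) * (yM x' - \<phi> x')"
      unfolding \<phi>(1) \<gamma>(1) by (simp add: algebra_simps)
    thus ?case using elim by (simp add: frac_eq_eq mult.commute)
  qed
  thus ?thesis unfolding has_field_derivative_iff by (rule Lim_transform_eventually[OF lim])
qed

text \<open>For an interior end, the upper bound on the speed combines \<open>\<epsilon> \<le> L * h\<^sup>2 * s\<close> with the width bound
  \<open>h\<^sup>3 \<le> K * \<epsilon>\<close>, and the lower one uses \<open>s\<^sup>2 \<le> K * L * h\<^sup>2\<close>. Otherwise \<open>\<xi>\<close> is positive at \<open>b1\<close>, and the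
  end stays there for all nearby \<open>x\<close>.\<close>

lemma yM_derivative:
  assumes x: "x \<in> {a0..b0}" and nz: "\<xi> f g x b1 \<noteq> 0"
  shows "\<exists>d. (yM has_real_derivative d) (at x within {a0..b0}) \<and> 0 \<le> d \<and> d \<le> L * K \<and>
    (yM x < b1 \<longrightarrow> l / (2 * L) / sqrt (K * L) \<le> d)"
proof (cases "yM x < b1")
  case True
  let ?h = "yM x - ym x" and ?s = "xbary (yM x) - x"
  let ?d = "(yM x - bary x) / ?s"
  have h: "0 < ?h" using section_nondegenerate[OF x] by simp
  note s = end_slope[OF x True]
  have qF: "0 \<le> yM x - bary x" "yM x - bary x \<le> ?h" using bary_in_section[OF x] by auto
  have "(yM x - bary x) * \<epsilon> \<le> ?h * (L * ?h\<^sup>2 * ?s)"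
    using s(1) qF \<epsilon>_pos h by (intro mult_mono) auto
  also have "\<dots> = L * ?h ^ 3 * ?s" by (simp add: power3_eq_cube power2_eq_square)
  also have "\<dots> \<le> L * (K * \<epsilon>) * ?s"
    using section_width[OF x] L_pos s(2) by (intro mult_right_mono mult_left_mono) auto
  finally have "(yM x - bary x) * \<epsilon> \<le> (L * K * ?s) * \<epsilon>" by (simp add: mult_ac)
  hence "yM x - bary x \<le> L * K * ?s" using \<epsilon>_pos by simp
  hence upper: "?d \<le> L * K" using s(2) by (simp add: pos_divide_le_eq)
  have KL: "0 < K * L" using K_pos L_pos by simp
  have "sqrt (?s\<^sup>2) \<le> sqrt (K * L * ?h\<^sup>2)" using s(3) by (rule real_sqrt_le_mono)
  hence "?s \<le> sqrt (K * L) * ?h" using s(2) h by (simp add: real_sqrt_mult)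
  hence "l / (2 * L) / sqrt (K * L) * ?s \<le> l / (2 * L) / sqrt (K * L) * (sqrt (K * L) * ?h)"
    using l_pos L_pos KL by (intro mult_left_mono) auto
  also have "\<dots> = l / (2 * L) * ?h" using K_pos L_pos by simp
  also have "\<dots> \<le> yM x - bary x" by (rule bary_bounds(1)[OF x])
  finally have "l / (2 * L) / sqrt (K * L) \<le> ?d" using s(2) by (simp add: pos_le_divide_eq)
  moreover have "0 \<le> ?d" using qF s(2) by simp
  ultimately show ?thesis using yM_derivative_interior[OF x True] upper by blast
next
  case False
  hence q: "yM x = b1" using section_subset[OF x] by auto
  have "0 \<le> \<xi> f g x (yM x)" using in_section_iff[OF x, of "yM x"] section_interval(2)[OF x] by auto
  hence "0 < \<xi> f g x b1" using nz q by simp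
  from \<xi>_pos_eventually[OF x this] eventually_in_domain
  have "\<forall>\<^sub>F x' in at x within {a0..b0}. yM x = yM x'"
  proof eventually_elim
    case (elim x')
    hence "b1 \<in> {ym x'..yM x'}" using lt1 by (subst in_section_iff) auto
    thus ?case using section_subset[OF elim(2)] q by auto
  qed
  hence "(yM has_real_derivative 0) (at x within {a0..b0})"
    unfolding has_field_derivative_iff
    by (intro Lim_transform_eventually[OF tendsto_const]) (auto elim: eventually_mono)
  moreover have "0 \<le> L * K" using K_pos L_pos by simp
  ultimately show ?thesis using False by (intro exI[of _ 0]) auto
qed

lemma ym_derivative:
  assumes x: "x \<in> {a0..b0}" and nz: "\<xi> f g x a1 \<noteq> 0"
  shows "\<exists>d. (ym has_real_derivative d) (at x within {a0..b0}) \<and> 0 \<le> d \<and> d \<le> L * K \<and>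
    (a1 < ym x \<longrightarrow> l / (2 * L) / sqrt (K * L) \<le> d)"
proof -
  interpret rf: qot_system l L \<epsilon> "-b0" "-a0" "\<lambda>x. u0 (-x)" "\<lambda>x. f (-x)" "-b1" "-a1" "\<lambda>y. u1 (-y)" "\<lambda>y. g (-y)"
    by (rule reflected)
  have "- x \<in> {-b0..-a0}" "\<xi> (\<lambda>x. f (-x)) (\<lambda>y. g (-y)) (-x) (-a1) \<noteq> 0"
    using x nz by (auto simp: \<xi>_def)
  from rf.yM_derivative[OF this] obtain d where d:
    "(rf.yM has_real_derivative d) (at (- x) within {-b0..-a0})" "0 \<le> d" "d \<le> L * K"
    "rf.yM (-x) < - a1 \<longrightarrow> l / (2 * L) / sqrt (K * L) \<le> d" by blast
  have img: "uminus ` {a0..b0} = {-b0..-a0}" by simp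
  have "((\<lambda>x. - rf.yM (- x)) has_real_derivative - (d * (- 1))) (at x within {a0..b0})"
    using DERIV_image_chain[OF _ DERIV_minus[OF DERIV_ident], of rf.yM d x "{a0..b0}"] d(1)
    unfolding img comp_def by (intro DERIV_minus)
  hence "((\<lambda>x. - rf.yM (- x)) has_real_derivative d) (at x within {a0..b0})" by simp
  hence "(ym has_real_derivative d) (at x within {a0..b0})"
    by (rule has_field_derivative_transform_within[OF _ zero_less_one x]) (simp add: reflected_sections(2))
  thus ?thesis using d reflected_sections(2)[OF x] by auto
qed

text \<open>An end contributes to the derivative of the barycentre in proportion to its speed and to its distance
  from the barycentre. Both contributions are nonnegative, and the smallness of \<open>\<epsilon>\<close> ensures
  that one of the ends is interior and contributes a definite amount.\<close>

lemma bary_derivative: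
  assumes x: "x \<in> {a0..b0}" and nz: "\<xi> f g x a1 \<noteq> 0" "\<xi> f g x b1 \<noteq> 0"
    and small: "K * \<epsilon> < (b1 - a1) ^ 3"
  shows "\<exists>d. (bary has_real_derivative d) (at x within {a0..b0}) \<and> curvature_lower l L \<le> d \<and> d \<le> curvature_upper l L"
proof -
  let ?X = "{a0..b0}" and ?Y = "{a1..b1}"
  let ?p = "ym x" and ?q = "yM x" and ?c = "l / (2 * L) / sqrt (K * L)"
  let ?h = "?q - ?p"
  obtain d where d: "(yM has_real_derivative d) (at x within ?X)" "0 \<le> d" "d \<le> L * K"
    "?q < b1 \<longrightarrow> ?c \<le> d" using yM_derivative[OF x nz(2)] by blast
  obtain e where e: "(ym has_real_derivative e) (at x within ?X)" "0 \<le> e" "e \<le> L * K"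
    "a1 < ?p \<longrightarrow> ?c \<le> e" using ym_derivative[OF x nz(1)] by blast
  have pq: "?p \<in> ?Y" "?q \<in> ?Y" using section_subset[OF x] section_interval(2)[OF x] by auto
  have h: "0 < ?h" using section_nondegenerate[OF x] by simp
  have im: "yM ` ?X \<subseteq> ?Y" "ym ` ?X \<subseteq> ?Y" using section_subset section_interval(2) by fastforce+
  have prim: "((\<lambda>x. integral {a1..k x} w) has_real_derivative w (k x) * k') (at x within ?X)"
    if "continuous_on ?Y w" "(k has_real_derivative k') (at x within ?X)" "k ` ?X \<subseteq> ?Y"
    for w k :: "real \<Rightarrow> real" and k'
  proof -
    have "k x \<in> ?Y" using that(3) x by blast
    hence "((\<lambda>y. integral {a1..y} w) has_real_derivative w (k x)) (at (k x) within k ` ?X)"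
      by (intro DERIV_subset[OF integral_has_real_derivative[OF that(1)] that(3)]) auto
    from DERIV_image_chain[OF this that(2)] show ?thesis by (simp add: comp_def)
  qed
  have yu: "continuous_on ?Y (\<lambda>y. y * u1 y)" by (intro continuous_intros cont_u1)
  let ?N' = "?q * u1 ?q * d - ?p * u1 ?p * e" and ?D' = "u1 ?q * d - u1 ?p * e"
  let ?d = "(u1 ?q * (?q - bary x) * d + u1 ?p * (bary x - ?p) * e) / mass x"
  have mb: "0 < mass x" "l * ?h \<le> mass x" "mass x \<le> L * ?h" using mass_bounds[OF x] by auto
  have "((\<lambda>x. integral {a1..yM x} u1 - integral {a1..ym x} u1) has_real_derivative ?D') (at x within ?X)"
    by (intro DERIV_diff prim cont_u1 d(1) e(1) im)
  hence D': "(mass has_real_derivative ?D') (at x within ?X)"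
    by (rule has_field_derivative_transform_within[OF _ zero_less_one x]) (simp add: mass_moment_primitive)
  have "((\<lambda>x. integral {a1..yM x} (\<lambda>y. y * u1 y) - integral {a1..ym x} (\<lambda>y. y * u1 y))
      has_real_derivative ?N') (at x within ?X)"
    by (intro DERIV_diff prim[OF yu] d(1) e(1) im)
  hence N': "(moment has_real_derivative ?N') (at x within ?X)"
    by (rule has_field_derivative_transform_within[OF _ zero_less_one x]) (simp add: mass_moment_primitive)
  have "((\<lambda>x. moment x / mass x) has_real_derivative (?N' * mass x - moment x * ?D') / (mass x * mass x)) (at x within ?X)"
    using mb by (intro DERIV_divide N' D') auto
  moreover have "(?N' * mass x - moment x * ?D') / (mass x * mass x) = ?d"
    using mb(1) by (simp add: bary_def field_simps)
  ultimately have deriv: "(bary has_real_derivative ?d) (at x within ?X)"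
    by (simp add: bary_def[abs_def])
  note bb = bary_bounds[OF x] bary_in_section[OF x]
  have u: "l \<le> u1 ?p" "u1 ?p \<le> L" "l \<le> u1 ?q" "u1 ?q \<le> L" using u1_bounds pq by auto
  have up: "w * r * k \<le> L * ?h * (L * K)"
    if "0 \<le> w" "w \<le> L" "0 \<le> r" "r \<le> ?h" "0 \<le> k" "k \<le> L * K" for w r k
    using that L_pos h by (intro mult_mono) auto
  have "u1 ?q * (?q - bary x) * d \<le> L * ?h * (L * K)" "u1 ?p * (bary x - ?p) * e \<le> L * ?h * (L * K)"
    by (rule up; use u l_pos bb d e in linarith)+
  moreover have "curvature_upper l L * (l * ?h) = 2 * (L * ?h * (L * K))"
    using l_pos by (simp add: curvature_upper_def power2_eq_square)
  ultimately have "u1 ?q * (?q - bary x) * d + u1 ?p * (bary x - ?p) * e \<le> curvature_upper l L * (l * ?h)"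
    by linarith
  also have "\<dots> \<le> curvature_upper l L * mass x"
    using mb(2) l_pos L_pos K_pos by (intro mult_left_mono) (auto simp: curvature_upper_def)
  finally have upper: "?d \<le> curvature_upper l L" using mb(1) by (simp add: pos_divide_le_eq)
  have KL: "0 < sqrt (K * L)" using K_pos L_pos by simp
  have c: "0 < ?c" using KL l_pos L_pos by simp
  have lo: "l * (l / (2 * L) * ?h) * ?c \<le> w * r * k"
    if "l \<le> w" "l / (2 * L) * ?h \<le> r" "?c \<le> k" for w r k
  proof (rule mult_mono)
    show "l * (l / (2 * L) * ?h) \<le> w * r"
      using that l_pos L_pos h by (intro mult_mono) auto
    have "0 \<le> l / (2 * L) * ?h" using l_pos L_pos h by simp
    thus "0 \<le> w * r" using that l_pos by (intro mult_nonneg_nonneg) linarith+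
  qed (use that c in linarith)+
  have nn: "0 \<le> u1 ?q * (?q - bary x) * d" "0 \<le> u1 ?p * (bary x - ?p) * e"
    using u l_pos bb d(2) e(2) by (intro mult_nonneg_nonneg; linarith)+
  have "?h ^ 3 < (b1 - a1) ^ 3" using section_width[OF x] small by linarith
  hence "?h < b1 - a1" by (rule power_less_imp_less_base) (use lt1 in simp)
  (* the section is shorter than the whole interval, so one of its ends is interior *)
  then consider "?q < b1" | "a1 < ?p" using pq by fastforce
  hence "l * (l / (2 * L) * ?h) * ?c \<le> u1 ?q * (?q - bary x) * d + u1 ?p * (bary x - ?p) * e"
  proof cases
    case 1 thus ?thesis using lo[OF u(3) bb(1)] d(4) nn(2) by fastforce
  next
    case 2 thus ?thesis using lo[OF u(1) bb(2)] e(4) nn(1) by fastforce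
  qed
  moreover have "l * (l / (2 * L) * ?h) * c' = l\<^sup>2 * c' / (2 * L\<^sup>2) * (L * ?h)" for c'
    using L_pos by (simp add: power2_eq_square field_simps)
  hence "l * (l / (2 * L) * ?h) * ?c = curvature_lower l L * (L * ?h)"
    unfolding curvature_lower_def .
  moreover have "curvature_lower l L * mass x \<le> curvature_lower l L * (L * ?h)"
    using mb(3) c l_pos L_pos KL by (intro mult_left_mono) (auto simp: curvature_lower_def)
  ultimately have "curvature_lower l L \<le> ?d" using mb(1) by (simp add: pos_le_divide_eq)
  thus ?thesis using deriv upper by blast
qed

section \<open>The exceptional points and the regularity of the potential\<close>

text \<open>As \<open>f' < b1\<close>, the function \<open>\<xi>(\<cdot>, b1)\<close> is strictly increasing. It is positive somewhere, hence at
  \<open>b0\<close>; were it nonnegative at \<open>a0\<close>, the \<open>x\<close>-section over \<open>b1\<close> would be all of \<open>[a0, b0]\<close>,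
  which the smallness of \<open>\<epsilon>\<close> excludes.\<close>

lemma top_zero:
  assumes small: "K * \<epsilon> < (b0 - a0) ^ 3"
  shows "\<exists>z\<in>{a0<..<b0}. \<forall>x\<in>{a0..b0}. \<xi> f g x b1 = 0 \<longleftrightarrow> x = z"
proof -
  interpret sw: qot_system l L \<epsilon> a1 b1 u1 g a0 b0 u0 f by (rule swapped)
  have b1: "b1 \<in> {a1..b1}" using lt1 by simp
  have mono: "\<xi> f g x b1 < \<xi> f g x' b1" if x: "x \<in> {a0..b0}" "x' \<in> {a0..b0}" "x < x'" for x x'
  proof -
    have "f x' - f x \<le> bary x' * (x' - x)" using bary_subgradient[OF x(2,1)] by (simp add: algebra_simps)
    also have "\<dots> < b1 * (x' - x)"
      using bary_in_section(2)[OF x(2)] section_subset(2)[OF x(2)] x(3) by (intro mult_strict_right_mono) auto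
    finally show ?thesis by (simp add: \<xi>_def algebra_simps)
  qed
  have ends: "a0 \<in> {a0..b0}" "b0 \<in> {a0..b0}" using lt0 by auto
  obtain x where x: "x \<in> {a0..b0}" "0 < \<xi> f g x b1" using sw.\<xi>_pos_exists[OF b1] by (auto simp: \<xi>_swap)
  hence top: "0 < \<xi> f g b0 b1" using mono[OF x(1) ends(2)] by (cases "x = b0") auto
  have bot: "\<xi> f g a0 b1 < 0"
  proof (rule ccontr)
    assume "\<not> ?thesis"
    hence "a0 \<in> {sw.ym b1..sw.yM b1}" "b0 \<in> {sw.ym b1..sw.yM b1}"
      using top ends by (auto simp: swapped_section_iff[OF b1] simp del: atLeastAtMost_iff)
    hence "(b0 - a0) ^ 3 \<le> (sw.yM b1 - sw.ym b1) ^ 3" using lt0 by (intro power_mono) auto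
    thus False using sw.section_width[OF b1] small by linarith
  qed
  obtain z where z: "a0 \<le> z" "z \<le> b0" "\<xi> f g z b1 = 0"
    using IVT'[of "\<lambda>x. \<xi> f g x b1" a0 0 b0] top bot lt0 cont_\<xi>_fst by auto
  have "z \<noteq> a0" "z \<noteq> b0" using z top bot by auto
  hence "z \<in> {a0<..<b0}" using z by simp
  moreover have "x = z" if "x \<in> {a0..b0}" "\<xi> f g x b1 = 0" for x
    using mono[of x z] mono[of z x] that z by (cases x z rule: linorder_cases) auto
  ultimately show ?thesis using z(3) by blast
qed

lemma is_x_M_iff: "is_x_M a0 b0 a1 b1 f g x \<longleftrightarrow> x \<in> {a0<..<b0} \<and> \<xi> f g x b1 = 0"
proof -
  have "yM x = b1" if "x \<in> {a0<..<b0}" "\<xi> f g x b1 = 0"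
  proof -
    have x: "x \<in> {a0..b0}" using that by auto
    have "b1 \<in> {ym x..yM x}" using that(2) lt1 by (subst in_section_iff[OF x]) auto
    thus ?thesis using section_subset(2)[OF x] by auto
  qed
  thus ?thesis unfolding is_x_M_def by metis
qed

lemma is_x_m_iff: "is_x_m a0 b0 a1 b1 f g x \<longleftrightarrow> x \<in> {a0<..<b0} \<and> \<xi> f g x a1 = 0"
proof -
  have "ym x = a1" if "x \<in> {a0<..<b0}" "\<xi> f g x a1 = 0"
  proof -
    have x: "x \<in> {a0..b0}" using that by auto
    have "a1 \<in> {ym x..yM x}" using that(2) lt1 by (subst in_section_iff[OF x]) auto
    thus ?thesis using section_subset(1)[OF x] by auto
  qed
  thus ?thesis unfolding is_x_m_def by metis
qed

lemma bottom_zero: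
  assumes small: "K * \<epsilon> < (b0 - a0) ^ 3"
  shows "\<exists>z\<in>{a0<..<b0}. \<forall>x\<in>{a0..b0}. \<xi> f g x a1 = 0 \<longleftrightarrow> x = z"
proof -
  interpret rf: qot_system l L \<epsilon> "-b0" "-a0" "\<lambda>x. u0 (-x)" "\<lambda>x. f (-x)" "-b1" "-a1" "\<lambda>y. u1 (-y)" "\<lambda>y. g (-y)"
    by (rule reflected)
  have s: "\<xi> (\<lambda>x. f (-x)) (\<lambda>y. g (-y)) x (-a1) = \<xi> f g (-x) a1" for x by (simp add: \<xi>_def)
  obtain z where z: "z \<in> {-b0<..<-a0}" "\<And>x. x \<in> {-b0..-a0} \<Longrightarrow> \<xi> f g (-x) a1 = 0 \<longleftrightarrow> x = z"
    using rf.top_zero small unfolding s by auto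
  have "\<xi> f g x a1 = 0 \<longleftrightarrow> x = - z" if "x \<in> {a0..b0}" for x
    using z(2)[of "-x"] that by auto
  moreover have "- z \<in> {a0<..<b0}" using z(1) by simp
  ultimately show ?thesis by blast
qed

lemma regularity:
  assumes small: "K * \<epsilon> < (b0 - a0) ^ 3" "K * \<epsilon> < (b1 - a1) ^ 3"
    and C: "0 < C" "curvature_upper l L \<le> C" "1 / C \<le> curvature_lower l L"
  shows "let S = {a0..b0};
             xm = x_m a0 b0 a1 b1 f g;
             xM = x_M a0 b0 a1 b1 f g;
             f'' = (\<lambda>x. ereal (deriv2_on S f x))
         in (\<exists>!x. is_x_m a0 b0 a1 b1 f g x) \<and> (\<exists>!x. is_x_M a0 b0 a1 b1 f g x) \<and>
            convex_on S f \<and> C1_on S f \<and>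
            (AE x in lebesgue_on S. twice_differentiable_within S f x) \<and>
            (\<forall>x\<in>S - {xm, xM}. twice_differentiable_within S f x) \<and>
            strongly_convex_on S (1 / C) f \<and>
            esssup (lebesgue_on S) f'' \<le> ereal C \<and>
            essinf (lebesgue_on S) f'' \<ge> ereal (1 / C) \<and>
            (SUP x\<in>S - {xm, xM}. f'' x) \<le> ereal C \<and>
            (INF x\<in>S - {xm, xM}. f'' x) \<ge> ereal (1 / C)"
proof -
  let ?S = "{a0..b0}"
  obtain zM where zM: "zM \<in> {a0<..<b0}" "\<And>x. x \<in> ?S \<Longrightarrow> \<xi> f g x b1 = 0 \<longleftrightarrow> x = zM"
    using top_zero[OF small(1)] by blast
  obtain zm where zm: "zm \<in> {a0<..<b0}" "\<And>x. x \<in> ?S \<Longrightarrow> \<xi> f g x a1 = 0 \<longleftrightarrow> x = zm"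
    using bottom_zero[OF small(1)] by blast
  have sub: "{a0<..<b0} \<subseteq> ?S" by auto
  have isM: "is_x_M a0 b0 a1 b1 f g x \<longleftrightarrow> x = zM" for x
    unfolding is_x_M_iff using zM sub by blast
  have ism: "is_x_m a0 b0 a1 b1 f g x \<longleftrightarrow> x = zm" for x
    unfolding is_x_m_iff using zm sub by blast
  have xM: "x_M a0 b0 a1 b1 f g = zM" unfolding x_M_def isM by simp
  have xm: "x_m a0 b0 a1 b1 f g = zm" unfolding x_m_def ism by simp
  let ?E = "{zm, zM}"
  have dF: "\<exists>d. (bary has_real_derivative d) (at x within ?S) \<and> 1 / C \<le> d \<and> d \<le> C"
    if x: "x \<in> ?S - ?E" for x
  proof -
    have "\<xi> f g x a1 \<noteq> 0" "\<xi> f g x b1 \<noteq> 0" using zm(2) zM(2) x by auto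
    with bary_derivative[of x] x small(2) C show ?thesis by fastforce
  qed
  have d1: "deriv_on ?S f x = bary x" if "x \<in> ?S" for x
    unfolding deriv_on_def using f_has_derivative[OF that] that lt0
    by (intro vector_derivative_within_closed_interval)
       (auto simp: has_real_derivative_iff_has_vector_derivative)
  have d2': "(deriv_on ?S f has_real_derivative d) (at x within ?S)"
    if "x \<in> ?S" "(bary has_real_derivative d) (at x within ?S)" for x d
    by (rule has_field_derivative_transform_within[OF that(2) zero_less_one that(1)]) (simp add: d1)
  have d2: "(bary has_real_derivative deriv2_on ?S f x) (at x within ?S)"
    "1 / C \<le> deriv2_on ?S f x" "deriv2_on ?S f x \<le> C" if x: "x \<in> ?S - ?E" for x
  proof -
    obtain d where d: "(bary has_real_derivative d) (at x within ?S)" "1 / C \<le> d" "d \<le> C"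
      using dF[OF x] by blast
    have "deriv2_on ?S f x = d"
      unfolding deriv2_on_def deriv_on_def[of ?S "deriv_on ?S f"]
      using d2'[OF _ d(1)] x lt0
      by (intro vector_derivative_within_closed_interval)
         (auto simp: has_real_derivative_iff_has_vector_derivative)
    thus "(bary has_real_derivative deriv2_on ?S f x) (at x within ?S)"
      "1 / C \<le> deriv2_on ?S f x" "deriv2_on ?S f x \<le> C" using d by auto
  qed
  have tw: "twice_differentiable_within ?S f x" if x: "x \<in> ?S - ?E" for x
    unfolding twice_differentiable_within_def
  proof (intro conjI)
    have f_diff: "f differentiable (at z within ?S)" if "z \<in> ?S" for z
      using f_has_derivative[OF that] by (meson real_differentiable_def)
    thus "f differentiable (at x within ?S)" using x by blast
    show "\<forall>\<^sub>F z in at x within ?S. f differentiable (at z within ?S)"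
      using eventually_in_domain by eventually_elim (rule f_diff)
    show "deriv_on ?S f differentiable (at x within ?S)"
      using d2'[OF _ d2(1)[OF x]] x by (meson DiffD1 real_differentiable_def)
  qed
  have fin: "finite ?E" by simp
  have growth: "1 / C * (x' - x) \<le> bary x' - bary x" if "x \<in> ?S" "x' \<in> ?S" "x \<le> x'" for x x'
    by (rule derivative_growth[OF cont_bary fin d2(1) d2(2) that])
  have strong: "strongly_convex_on ?S (1 / C) f"
    by (rule strongly_convex_on_if_derivative_growth[OF f_has_derivative growth])
  have C1: "C1_on ?S f"
    unfolding C1_on_def using f_has_derivative cont_bary by blast
  have meas: "deriv2_on ?S f \<in> borel_measurable (lebesgue_on ?S)"
    by (rule derivative_measurable[OF lt0 cont_bary fin d2(1)])
  have meas': "(\<lambda>x. ereal (deriv2_on ?S f x)) \<in> borel_measurable (lebesgue_on ?S)"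
    "(\<lambda>x. - ereal (deriv2_on ?S f x)) \<in> borel_measurable (lebesgue_on ?S)"
    using meas by measurable
  have up: "esssup (lebesgue_on ?S) (\<lambda>x. ereal (deriv2_on ?S f x)) \<le> ereal C"
    by (rule esssup_I[OF meas'(1) AE_lebesgue_on_except_finite[OF fin]]) (use d2(3) in simp)
  have "esssup (lebesgue_on ?S) (\<lambda>x. - ereal (deriv2_on ?S f x)) \<le> - ereal (1 / C)"
    by (rule esssup_I[OF meas'(2) AE_lebesgue_on_except_finite[OF fin]]) (use d2(2) in simp)
  hence lo: "ereal (1 / C) \<le> essinf (lebesgue_on ?S) (\<lambda>x. ereal (deriv2_on ?S f x))"
    unfolding essinf_def by (metis ereal_minus_le_minus ereal_uminus_uminus)
  have sup: "(SUP x\<in>?S - ?E. ereal (deriv2_on ?S f x)) \<le> ereal C"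
    by (rule SUP_least) (simp only: ereal_less_eq d2(3))
  have inf: "ereal (1 / C) \<le> (INF x\<in>?S - ?E. ereal (deriv2_on ?S f x))"
    by (rule INF_greatest) (simp only: ereal_less_eq d2(2))
  show ?thesis
    unfolding Let_def xm xM isM ism
    by (intro conjI ballI convex_f C1 strong up lo sup inf tw AE_lebesgue_on_except_finite[OF fin tw]) simp_all
qed

end

section \<open>From the regularized transport problem to the marginal equations\<close>

lemma density_pair_marginals:
  assumes "sigma_finite_measure M" "sigma_finite_measure N"
    and sets: "sets M = sets borel" "sets N = sets borel"
    and k: "k \<in> borel_measurable (M \<Otimes>\<^sub>M N)"
  shows "distr (density (M \<Otimes>\<^sub>M N) k) borel fst = density M (\<lambda>x. \<integral>\<^sup>+ y. k (x, y) \<partial>N)"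
    and "distr (density (M \<Otimes>\<^sub>M N) k) borel snd = density N (\<lambda>y. \<integral>\<^sup>+ x. k (x, y) \<partial>M)"
proof -
  interpret M: sigma_finite_measure M by fact
  interpret N: sigma_finite_measure N by fact
  interpret pair_sigma_finite M N ..
  note [measurable] = k
  note [measurable_cong] = sets
  let ?P = "M \<Otimes>\<^sub>M N"
  have m: "(\<lambda>x. \<integral>\<^sup>+ y. k (x, y) \<partial>N) \<in> borel_measurable M" "(\<lambda>y. \<integral>\<^sup>+ x. k (x, y) \<partial>M) \<in> borel_measurable N"
    by measurable
  show "distr (density ?P k) borel fst = density M (\<lambda>x. \<integral>\<^sup>+ y. k (x, y) \<partial>N)"
  proof (rule measure_eqI)
    fix A assume "A \<in> sets (distr (density ?P k) borel fst)"
    hence A[measurable]: "A \<in> sets borel" by simp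
    have "emeasure (distr (density ?P k) borel fst) A = (\<integral>\<^sup>+ z. k z * indicator A (fst z) \<partial>?P)"
      by (subst emeasure_distr, simp_all, subst emeasure_density, simp_all)
         (intro nn_integral_cong, auto simp: indicator_def space_pair_measure)
    also have "\<dots> = (\<integral>\<^sup>+ x. \<integral>\<^sup>+ y. k (x, y) * indicator A x \<partial>N \<partial>M)"
      by (subst N.nn_integral_fst[symmetric]) simp_all
    also have "\<dots> = emeasure (density M (\<lambda>x. \<integral>\<^sup>+ y. k (x, y) \<partial>N)) A"
      using sets by (subst emeasure_density[OF m(1)]) (auto intro!: nn_integral_cong nn_integral_multc)
    finally show "emeasure (distr (density ?P k) borel fst) A
      = emeasure (density M (\<lambda>x. \<integral>\<^sup>+ y. k (x, y) \<partial>N)) A" .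
  qed (simp add: sets)
  show "distr (density ?P k) borel snd = density N (\<lambda>y. \<integral>\<^sup>+ x. k (x, y) \<partial>M)"
  proof (rule measure_eqI)
    fix A assume "A \<in> sets (distr (density ?P k) borel snd)"
    hence A[measurable]: "A \<in> sets borel" by simp
    have "emeasure (distr (density ?P k) borel snd) A = (\<integral>\<^sup>+ z. k z * indicator A (snd z) \<partial>?P)"
      by (subst emeasure_distr, simp_all, subst emeasure_density, simp_all)
         (intro nn_integral_cong, auto simp: indicator_def space_pair_measure)
    also have "\<dots> = (\<integral>\<^sup>+ y. \<integral>\<^sup>+ x. k (x, y) * indicator A y \<partial>M \<partial>N)"
      by (subst nn_integral_snd[symmetric]) simp_all
    also have "\<dots> = emeasure (density N (\<lambda>y. \<integral>\<^sup>+ x. k (x, y) \<partial>M)) A"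
      using sets by (subst emeasure_density[OF m(2)]) (auto intro!: nn_integral_cong nn_integral_multc)
    finally show "emeasure (distr (density ?P k) borel snd) A
      = emeasure (density N (\<lambda>y. \<integral>\<^sup>+ x. k (x, y) \<partial>M)) A" .
  qed (simp add: sets)
qed

lemma marginal_with_densityD:
  assumes "marginal_with_density l L a b u \<mu>"
  shows "prob_space \<mu>" "\<mu> = density lborel (\<lambda>x. ennreal (indicator {a..b} x * u x))"
    "continuous_on {a..b} u" "\<And>x. x \<in> {a..b} \<Longrightarrow> l \<le> u x \<and> u x \<le> L"
    "(\<lambda>x. indicator {a..b} x * u x) \<in> borel_measurable borel"
    "sets \<mu> = sets borel" "a < b" "AE x in \<mu>. x \<in> {a..b}"
proof -
  show 1: "prob_space \<mu>" "\<mu> = density lborel (\<lambda>x. ennreal (indicator {a..b} x * u x))"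
    "continuous_on {a..b} u" "\<And>x. x \<in> {a..b} \<Longrightarrow> l \<le> u x \<and> u x \<le> L"
    using assms unfolding marginal_with_density_def by auto
  show 2: "(\<lambda>x. indicator {a..b} x * u x) \<in> borel_measurable borel"
    using borel_measurable_continuous_on_indicator[OF _ 1(3)] by simp
  show 3: "sets \<mu> = sets borel" by (subst 1(2)) simp
  show 4: "AE x in \<mu>. x \<in> {a..b}"
    by (subst 1(2), subst AE_density) (use 2 in \<open>auto simp: indicator_def\<close>)
  show "a < b"
  proof (rule ccontr)
    assume "\<not> a < b"
    hence "AE x in lborel. x \<notin> {a..b}"
      by (cases "a = b") (auto intro: AE_lborel_singleton)
    hence "AE x in \<mu>. x \<notin> {a..b}"
      by (subst 1(2), subst AE_density) (use 2 in auto)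
    with 4 have "AE x in \<mu>. False" by eventually_elim simp
    thus False using prob_space.AE_False[OF 1(1)] by simp
  qed
qed

text \<open>The potentials are controlled on their intervals only, so measurability is obtained after extending
  them by zero. The equation then holds almost everywhere, and both sides are continuous in \<open>x\<close>, so
  it holds everywhere, because \<open>\<mu>\<close> charges every open part of \<open>[a, b]\<close>.\<close>

lemma marginal_equation_from_AE:
  assumes m0: "marginal_with_density l L a b u \<mu>" and m1: "marginal_with_density l L c d v \<nu>"
    and "0 < l" "0 < \<epsilon>" and f: "continuous_on {a..b} f" and g: "continuous_on {c..d} g"
    and AE: "AE x in \<mu>. (\<integral>\<^sup>+ y. ennreal (max (\<xi> (\<lambda>x. indicator {a..b} x * f x) (\<lambda>y. indicator {c..d} y * g y) x y / \<epsilon>) 0) \<partial>\<nu>) = 1"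
    and x: "x \<in> {a..b}"
  shows "integral {c..d} (\<lambda>y. max (\<xi> f g x y) 0 * v y) = \<epsilon>"
proof -
  note D0 = marginal_with_densityD[OF m0] and D1 = marginal_with_densityD[OF m1]
  let ?f = "\<lambda>x. indicator {a..b} x * f x" and ?g = "\<lambda>y. indicator {c..d} y * g y"
  have g_meas: "?g \<in> borel_measurable borel"
    using borel_measurable_continuous_on_indicator[OF _ g] by simp
  define H where "H x = integral {c..d} (\<lambda>y. max (\<xi> f g x y) 0 * v y)" for x
  have inner: "(\<integral>\<^sup>+ y. ennreal (max (\<xi> ?f ?g x y / \<epsilon>) 0) \<partial>\<nu>) = ennreal (H x / \<epsilon>)"
    if x: "x \<in> {a..b}" for x
  proof -
    have m: "(\<lambda>y. ennreal (max (\<xi> ?f ?g x y / \<epsilon>) 0)) \<in> borel_measurable lborel"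
      unfolding \<xi>_def using g_meas by measurable
    have cont: "continuous_on {c..d} (\<lambda>y. max (\<xi> f g x y) 0 * v y)"
      unfolding \<xi>_def by (intro continuous_intros g D1(3))
    have v: "0 \<le> v y" if "y \<in> {c..d}" for y using D1(4)[OF that] \<open>0 < l\<close> by linarith
    have "(\<integral>\<^sup>+ y. ennreal (max (\<xi> ?f ?g x y / \<epsilon>) 0) \<partial>\<nu>)
        = (\<integral>\<^sup>+ y. ennreal (indicator {c..d} y * v y) * ennreal (max (\<xi> ?f ?g x y / \<epsilon>) 0) \<partial>lborel)"
      by (subst D1(2), subst nn_integral_density) (use D1(5) m in auto)
    also have "\<dots> = (\<integral>\<^sup>+ y. ennreal (indicator {c..d} y * (max (\<xi> f g x y) 0 * v y / \<epsilon>)) \<partial>lborel)"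
    proof (intro nn_integral_cong)
      fix y
      show "ennreal (indicator {c..d} y * v y) * ennreal (max (\<xi> ?f ?g x y / \<epsilon>) 0)
        = ennreal (indicator {c..d} y * (max (\<xi> f g x y) 0 * v y / \<epsilon>))"
      proof (cases "y \<in> {c..d}")
        case True
        have "v y * max (\<xi> f g x y / \<epsilon>) 0 = max (\<xi> f g x y) 0 * v y / \<epsilon>"
          using \<open>0 < \<epsilon>\<close> by (cases "0 < \<xi> f g x y") (auto simp: max_def divide_le_0_iff)
        hence "ennreal (v y) * ennreal (max (\<xi> f g x y / \<epsilon>) 0) = ennreal (max (\<xi> f g x y) 0 * v y / \<epsilon>)"
          by (metis ennreal_mult'[OF v[OF True]])
        moreover have "\<xi> ?f ?g x y = \<xi> f g x y" using True x by (simp add: \<xi>_def)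
        ultimately show ?thesis using True by (simp only: indicator_simps mult_1_left)
      qed simp
    qed
    also have "\<dots> = ennreal (H x / \<epsilon>)"
    proof (rule nn_integral_has_integral_lebesgue)
      show "0 \<le> max (\<xi> f g x y) 0 * v y / \<epsilon>" if "y \<in> {c..d}" for y
        using v[OF that] \<open>0 < \<epsilon>\<close> by simp
      have "((\<lambda>y. max (\<xi> f g x y) 0 * v y) has_integral H x) {c..d}"
        unfolding H_def by (intro integrable_integral integrable_continuous_interval cont)
      thus "((\<lambda>y. max (\<xi> f g x y) 0 * v y / \<epsilon>) has_integral H x / \<epsilon>) {c..d}"
        by (rule has_integral_divide)
    qed
    finally show ?thesis .
  qed
  have "continuous_on ({a..b} \<times> {c..d}) (\<lambda>z. f (fst z))"
    by (rule continuous_on_compose2[OF f]) (auto intro: continuous_intros)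
  moreover have "continuous_on ({a..b} \<times> {c..d}) (\<lambda>z. g (snd z))"
    by (rule continuous_on_compose2[OF g]) (auto intro: continuous_intros)
  moreover have "continuous_on ({a..b} \<times> {c..d}) (\<lambda>z. v (snd z))"
    by (rule continuous_on_compose2[OF D1(3)]) (auto intro: continuous_intros)
  ultimately have "continuous_on ({a..b} \<times> cbox c d) (\<lambda>(x, y). max (\<xi> f g x y) 0 * v y)"
    unfolding case_prod_unfold \<xi>_def box_real by (intro continuous_intros)
  hence H_cont: "continuous_on {a..b} H"
    unfolding H_def using integral_continuous_on_param[of "{a..b}" c d "\<lambda>x y. max (\<xi> f g x y) 0 * v y"]
    by simp
  let ?C = "{x \<in> {a..b}. H x = \<epsilon>}"
  have "?C = {a..b} \<inter> H -` {\<epsilon>}" by auto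
  hence C: "closed ?C" using continuous_closed_preimage[OF H_cont, of "{\<epsilon>}"] by simp
  have "AE x in \<mu>. H x = \<epsilon>"
    using AE D0(8)
  proof eventually_elim
    case (elim x)
    hence "ennreal (H x / \<epsilon>) = 1" using inner[of x] by simp
    thus ?case using \<open>0 < \<epsilon>\<close> by (simp add: ennreal_eq_1)
  qed
  hence "AE x in lborel. 0 < ennreal (indicator {a..b} x * u x) \<longrightarrow> H x = \<epsilon>"
    by (subst (asm) D0(2), subst (asm) AE_density) (use D0(5) in auto)
  hence "AE x in lborel. x \<in> {a<..<b} \<longrightarrow> x \<in> ?C"
  proof eventually_elim
    case (elim x)
    show ?case
    proof
      assume "x \<in> {a<..<b}"
      hence x: "x \<in> {a..b}" by simp
      hence "0 < u x" using D0(4)[of x] \<open>0 < l\<close> by linarith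
      thus "x \<in> ?C" using elim x by simp
    qed
  qed
  hence "AE x in lebesgue. x \<in> {a<..<b} \<longrightarrow> x \<in> ?C" by (rule AE_completion)
  hence "{a<..<b} \<subseteq> ?C"
    using mem_closed_if_AE_lebesgue_open[OF open_greaterThanLessThan C] by blast
  hence "closure {a<..<b} \<subseteq> ?C" by (rule closure_minimal[OF _ C])
  hence "x \<in> ?C" using x D0(7) by (simp add: closure_greaterThanLessThan subset_eq)
  thus ?thesis by (simp add: H_def)
qed

text \<open>The marginals of a plan with density \<open>k\<close> have the partial integrals of \<open>k\<close> as densities, and these
  must be \<open>1\<close> for a coupling.\<close>

lemma potentials_imp_qot_system:
  assumes m0: "marginal_with_density l L a0 b0 u0 \<mu>0" and m1: "marginal_with_density l L a1 b1 u1 \<mu>1"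
    and "0 < l" "0 < \<epsilon>" and pot: "qot_potentials \<epsilon> {a0..b0} {a1..b1} \<mu>0 \<mu>1 f g"
  shows "qot_system l L \<epsilon> a0 b0 u0 f a1 b1 u1 g"
proof -
  note D0 = marginal_with_densityD[OF m0] and D1 = marginal_with_densityD[OF m1]
  interpret \<mu>0: prob_space \<mu>0 by (rule D0)
  interpret \<mu>1: prob_space \<mu>1 by (rule D1)
  interpret pair_sigma_finite \<mu>0 \<mu>1 ..
  interpret P: pair_prob_space \<mu>0 \<mu>1 ..
  let ?P = "\<mu>0 \<Otimes>\<^sub>M \<mu>1"
  let ?f = "\<lambda>x. indicator {a0..b0} x * f x" and ?g = "\<lambda>y. indicator {a1..b1} y * g y"
  obtain \<pi> where cont: "continuous_on {a0..b0} f" "continuous_on {a1..b1} g"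
    and coup: "\<pi> \<in> couplings \<mu>0 \<mu>1" and ac: "absolutely_continuous ?P \<pi>"
    and RN: "AE z in ?P. RN_deriv ?P \<pi> z = ennreal (max (\<xi> f g (fst z) (snd z) / \<epsilon>) 0)"
    using pot unfolding qot_potentials_def qot_minimizer_def by (auto simp: case_prod_unfold)
  have [measurable]: "?f \<in> borel_measurable borel" "?g \<in> borel_measurable borel"
    using borel_measurable_continuous_on_indicator[OF _ cont(1)]
      borel_measurable_continuous_on_indicator[OF _ cont(2)] by simp_all
  note [measurable_cong] = D0(6) D1(6)
  define k where "k z = ennreal (max (\<xi> ?f ?g (fst z) (snd z) / \<epsilon>) 0)" for z
  have k_meas[measurable]: "k \<in> borel_measurable ?P" unfolding k_def \<xi>_def by measurable
  have "AE z in ?P. fst z \<in> {a0..b0} \<and> snd z \<in> {a1..b1}"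
  proof (rule AE_pair_measure)
    show "{z \<in> space ?P. fst z \<in> {a0..b0} \<and> snd z \<in> {a1..b1}} \<in> sets ?P" by measurable
    show "AE x in \<mu>0. AE y in \<mu>1. fst (x, y) \<in> {a0..b0} \<and> snd (x, y) \<in> {a1..b1}"
      using D0(8) by eventually_elim (use D1(8) in simp)
  qed
  with RN have RN_k: "AE z in ?P. RN_deriv ?P \<pi> z = k z"
    by eventually_elim (simp add: k_def \<xi>_def)
  have "sets \<pi> = sets (borel \<Otimes>\<^sub>M borel)" using coup by (simp add: couplings_def)
  also have "\<dots> = sets ?P" using D0(6) D1(6) by (intro sets_pair_measure_cong) auto
  finally have "density ?P (RN_deriv ?P \<pi>) = \<pi>" by (rule P.density_RN_deriv[OF ac])
  hence \<pi>: "\<pi> = density ?P k" using density_cong[OF _ k_meas RN_k] by simp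
  note marg = density_pair_marginals[OF \<mu>0.sigma_finite_measure_axioms \<mu>1.sigma_finite_measure_axioms
      D0(6) D1(6) k_meas]
  have "density \<mu>0 (\<lambda>x. \<integral>\<^sup>+ y. k (x, y) \<partial>\<mu>1) = density \<mu>0 (\<lambda>_. 1)"
    using coup marg(1) unfolding \<pi>[symmetric] by (simp add: couplings_def density_1)
  hence "AE x in \<mu>0. (\<integral>\<^sup>+ y. k (x, y) \<partial>\<mu>1) = 1" by (intro \<mu>0.density_unique) measurable
  hence AE0: "AE x in \<mu>0. (\<integral>\<^sup>+ y. ennreal (max (\<xi> ?f ?g x y / \<epsilon>) 0) \<partial>\<mu>1) = 1"
    by (simp add: k_def)
  have "density \<mu>1 (\<lambda>y. \<integral>\<^sup>+ x. k (x, y) \<partial>\<mu>0) = density \<mu>1 (\<lambda>_. 1)"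
    using coup marg(2) unfolding \<pi>[symmetric] by (simp add: couplings_def density_1)
  hence "AE y in \<mu>1. (\<integral>\<^sup>+ x. k (x, y) \<partial>\<mu>0) = 1" by (intro \<mu>1.density_unique) measurable
  hence AE1: "AE y in \<mu>1. (\<integral>\<^sup>+ x. ennreal (max (\<xi> ?g ?f y x / \<epsilon>) 0) \<partial>\<mu>0) = 1"
    by (simp add: k_def \<xi>_swap)
  show ?thesis
  proof unfold_locales
    show "integral {a1..b1} (\<lambda>y. max (\<xi> f g x y) 0 * u1 y) = \<epsilon>" if "x \<in> {a0..b0}" for x
      by (rule marginal_equation_from_AE[OF m0 m1 assms(3,4) cont AE0 that])
    show "integral {a0..b0} (\<lambda>x. max (\<xi> f g x y) 0 * u0 x) = \<epsilon>" if "y \<in> {a1..b1}" for y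
      using marginal_equation_from_AE[OF m1 m0 assms(3,4) cont(2,1) AE1 that] by (simp add: \<xi>_swap)
  qed (use assms(3,4) cont D0(3,4,7) D1(3,4,7) in auto)
qed

theorem theorem2p2:
  fixes l L :: real and \<omega>0 \<omega>1 :: "real \<Rightarrow> real"
  assumes "0 < l"
    and "modulus_of_continuity \<omega>0" and "modulus_of_continuity \<omega>1"
  shows "\<exists>C>0. \<forall>a0 b0 a1 b1 u0 u1 \<mu>0 \<mu>1.
    marginal_with_density l L a0 b0 u0 \<mu>0 \<and> has_modulus_on {a0..b0} u0 \<omega>0 \<and>
    marginal_with_density l L a1 b1 u1 \<mu>1 \<and> has_modulus_on {a1..b1} u1 \<omega>1 \<longrightarrow>
    (\<exists>\<epsilon>0>0. \<forall>\<epsilon>. 0 < \<epsilon> \<and> \<epsilon> < \<epsilon>0 \<longrightarrow>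
      (\<forall>f g. qot_potentials \<epsilon> {a0..b0} {a1..b1} \<mu>0 \<mu>1 f g \<longrightarrow>
        (let S = {a0..b0};
             xm = x_m a0 b0 a1 b1 f g;
             xM = x_M a0 b0 a1 b1 f g;
             f'' = (\<lambda>x. ereal (deriv2_on S f x))
         in (\<exists>!x. is_x_m a0 b0 a1 b1 f g x) \<and> (\<exists>!x. is_x_M a0 b0 a1 b1 f g x) \<and>
            convex_on S f \<and> C1_on S f \<and>
            (AE x in lebesgue_on S. twice_differentiable_within S f x) \<and>
            (\<forall>x\<in>S - {xm, xM}. twice_differentiable_within S f x) \<and>
            strongly_convex_on S (1 / C) f \<and>
            esssup (lebesgue_on S) f'' \<le> ereal C \<and>
            essinf (lebesgue_on S) f'' \<ge> ereal (1 / C) \<and>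
            (SUP x\<in>S - {xm, xM}. f'' x) \<le> ereal C \<and>
            (INF x\<in>S - {xm, xM}. f'' x) \<ge> ereal (1 / C))))"
proof (cases "l \<le> L")
  case False
  have "\<not> marginal_with_density l L a b u \<mu>" for a b u \<mu>
  proof
    assume m: "marginal_with_density l L a b u \<mu>"
    show False
      using marginal_with_densityD(4)[OF m, of a] marginal_with_densityD(7)[OF m] False by auto
  qed
  thus ?thesis by (intro exI[of _ 1]) simp
next
  case True
  let ?K = "width_const l L"
  define C where "C = max (curvature_upper l L) (1 / curvature_lower l L)"
  have L: "0 < L" using True assms(1) by linarith
  have K: "0 < ?K" using assms(1) L by (simp add: width_const_def)
  have lo: "0 < curvature_lower l L" and up: "0 < curvature_upper l L"
    using assms(1) L K by (auto simp: curvature_lower_def curvature_upper_def)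
  have C: "0 < C" "curvature_upper l L \<le> C" using up by (auto simp: C_def)
  have "1 / curvature_lower l L \<le> C" by (simp add: C_def)
  hence C': "1 / C \<le> curvature_lower l L" using lo C(1) by (simp add: field_simps)
  show ?thesis
  proof (rule exI[of _ C], intro conjI C(1) allI impI, elim conjE, goal_cases)
    case (1 a0 b0 a1 b1 u0 u1 \<mu>0 \<mu>1)
    note m = \<open>marginal_with_density l L a0 b0 u0 \<mu>0\<close> \<open>marginal_with_density l L a1 b1 u1 \<mu>1\<close>
    have lt: "a0 < b0" "a1 < b1" using m by (auto dest: marginal_with_densityD(7))
    show ?case
    proof (rule exI[of _ "min ((b0 - a0) ^ 3) ((b1 - a1) ^ 3) / ?K"], intro conjI allI impI, goal_cases)
      case 1
      show ?case using lt K by simp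
    next
      case (2 \<epsilon> f g)
      hence \<epsilon>: "0 < \<epsilon>" "\<epsilon> < min ((b0 - a0) ^ 3) ((b1 - a1) ^ 3) / ?K"
        and pot: "qot_potentials \<epsilon> {a0..b0} {a1..b1} \<mu>0 \<mu>1 f g" by auto
      have "?K * \<epsilon> < min ((b0 - a0) ^ 3) ((b1 - a1) ^ 3)"
        using \<epsilon>(2) K by (simp add: pos_less_divide_eq mult.commute)
      hence small: "?K * \<epsilon> < (b0 - a0) ^ 3" "?K * \<epsilon> < (b1 - a1) ^ 3" by auto
      show ?case
        by (rule qot_system.regularity[OF potentials_imp_qot_system[OF m assms(1) \<epsilon>(1) pot] small C C'])
    qed
  qed
qed

end
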